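(* Let $M\ge 2$ and $k\ge 3$ be integers such that $q_{M+1}k+(M+2)\log 3<q_M k-(M+1)\log 3$, and let $S_M^k$ be the strip $\{s=\sigma+it:\ q_M k-(M+1)\log 3\le \sigma\le q_M k+(M+1)\log 3\}$. (a) For every $j\in\mathbb{N}$, the rectangular region $R\subset S_M^k$ consisting of all $s=\sigma+it$ with $$q_M k-(M+1)\log 3<\sigma<q_M k+(M+1)\log 3,\qquad \frac{2\pi j}{\log(M+1)-\log M}<t<\frac{2\pi (j+1)}{\log(M+1)-\log M}$$ contains exactly one zero of $\zeta^{(k)}(s)$. (b) All zeros of $\zeta^{(k)}(s)$ lying in $S_M^k$ are simple.
   Context: $\zeta^{(k)}(s)$ denotes the $k$-th derivative of the Riemann zeta function, given for $\sigma=\Re s>1$ by $\zeta^{(k)}(s)=(-1)^k\sum_{n\ge 2}(\log n)^k n^{-s}$ and extended meromorphically to $\mathbb{C}$. For an integer $M\ge 2$, $$q_M:=\frac{\log\left(\frac{\log M}{\log(M+1)}\right)}{\log\left(\frac{M}{M+1}\right)}.$$ The paper calls $S_M^k$ (defined for $k\ge 3$, $M\ge 2$ whenever $q_{M+1}k+(M+2)\log 3<q_M k-(M+1)\log 3$) the critical strip of $\zeta^{(k)}$ with critical line $\sigma=q_M k$. *)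

theory Defs
  imports "HOL-Complex_Analysis.Complex_Analysis"
begin

text \<open>
  The connectedness of the punctured plane makes the analytic continuation unique away from
  the pole, so the choice operator leaves only the (irrelevant) value at \<open>1\<close> open. Existence is
  the lemma \<open>riemann_zeta_exists\<close> below.
\<close>
definition riemann_zeta :: "complex \<Rightarrow> complex" where
  "riemann_zeta = (SOME f. f holomorphic_on - {1} \<and>
     (\<forall>s. Re s > 1 \<longrightarrow> f s = (\<Sum>n. of_nat (Suc n) powr (- s))))"

definition zeta_deriv :: "nat \<Rightarrow> complex \<Rightarrow> complex" where
  "zeta_deriv k = (deriv ^^ k) riemann_zeta"

definition q :: "nat \<Rightarrow> real" where
  "q M = ln (ln (real M) / ln (real (M + 1))) / ln (real M / real (M + 1))"

definition critical_strip :: "nat \<Rightarrow> nat \<Rightarrow> complex set" where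
  "critical_strip M k =
     {s. q M * real k - real (M + 1) * ln 3 \<le> Re s \<and> Re s \<le> q M * real k + real (M + 1) * ln 3}"

definition critical_rectangle :: "nat \<Rightarrow> nat \<Rightarrow> nat \<Rightarrow> complex set" where
  "critical_rectangle M k j =
     {s. q M * real k - real (M + 1) * ln 3 < Re s \<and> Re s < q M * real k + real (M + 1) * ln 3 \<and>
         2 * pi * real j / (ln (real (M + 1)) - ln (real M)) < Im s \<and>
         Im s < 2 * pi * real (j + 1) / (ln (real (M + 1)) - ln (real M))}"


subsection \<open>Existence of the analytic continuation\<close>

lemma holomorphic_dirichlet_type_series:
  fixes u :: "nat \<Rightarrow> complex \<Rightarrow> complex" and K :: "complex \<Rightarrow> real"
  assumes hol: "\<And>n. u n holomorphic_on {s. Re s > b}"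
    and bound: "\<And>n s. Re s > b \<Longrightarrow> norm (u n s) \<le> K s * real (Suc n) powr (- Re s - m)"
    and K: "continuous_on UNIV K" and bm: "b + m \<ge> 1"
  shows "(\<lambda>s. \<Sum>n. u n s) holomorphic_on {s. Re s > b}"
proof (rule holomorphic_uniform_sequence[where f = "\<lambda>N s. \<Sum>n<N. u n s"])
  show "open {s. Re s > b}" by (rule open_halfspace_Re_gt)
  show "(\<lambda>s. \<Sum>n<N. u n s) holomorphic_on {s. Re s > b}" for N
    by (intro holomorphic_on_sum hol)
  fix x assume "x \<in> {s. Re s > b}"
  then have x: "Re x > b" by simp
  define d where "d = (Re x - b) / 2"
  have d: "d > 0" using x by (simp add: d_def)
  have ge: "Re s \<ge> b + d" if "s \<in> cball x d" for s
  proof -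
    have "\<bar>Re (x - s)\<bar> \<le> d"
      using that abs_Re_le_cmod[of "x - s"] by (simp add: dist_norm)
    then have "Re x - Re s \<le> d" by simp
    moreover have "Re x = b + 2 * d" unfolding d_def by (simp add: field_simps)
    ultimately show ?thesis by linarith
  qed
  have sub: "cball x d \<subseteq> {s. Re s > b}" using ge d by force
  have "compact (K ` cball x d)"
    by (intro compact_continuous_image continuous_on_subset[OF K]) auto
  then obtain C where C: "\<And>s. s \<in> cball x d \<Longrightarrow> \<bar>K s\<bar> \<le> C"
    using compact_imp_bounded[of "K ` cball x d"] unfolding bounded_iff real_norm_def
    by (meson imageI)
  have "uniform_limit (cball x d) (\<lambda>N s. \<Sum>n<N. u n s) (\<lambda>s. \<Sum>n. u n s) sequentially"
  proof (rule Weierstrass_m_test)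
    fix n s assume s: "s \<in> cball x d"
    have "norm (u n s) \<le> K s * real (Suc n) powr (- Re s - m)"
      using bound s sub by blast
    also have "\<dots> \<le> C * real (Suc n) powr (- (1 + d))"
    proof (rule mult_mono)
      show "K s \<le> C" "0 \<le> C" using C[OF s] by linarith+
      show "real (Suc n) powr (- Re s - m) \<le> real (Suc n) powr (- (1 + d))"
        using ge[OF s] bm by (intro powr_mono) auto
    qed auto
    finally show "norm (u n s) \<le> C * real (Suc n) powr (- (1 + d))" .
  next
    have "summable (\<lambda>n. real n powr (- (1 + d)))"
      using d by (subst summable_real_powr_iff) auto
    then have "summable (\<lambda>n. real (Suc n) powr (- (1 + d)))"
      by (subst summable_Suc_iff)
    then show "summable (\<lambda>n. C * real (Suc n) powr (- (1 + d)))"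
      by (rule summable_mult)
  qed
  then show "\<exists>d>0. cball x d \<subseteq> {s. b < Re s} \<and>
      uniform_limit (cball x d) (\<lambda>N s. \<Sum>n<N. u n s) (\<lambda>s. \<Sum>n. u n s) sequentially"
    using d sub by blast
qed

definition zeta_series :: "complex \<Rightarrow> complex" where
  "zeta_series s = (\<Sum>n. of_nat (Suc n) powr (- s))"

lemma norm_Suc_powr: "norm (of_nat (Suc n) powr (s :: complex)) = real (Suc n) powr Re s"
  by (subst norm_powr_real_powr) auto

lemma zeta_series_sums:
  assumes "Re s > 1"
  shows "(\<lambda>n. of_nat (Suc n) powr (- s)) sums zeta_series s"
proof -
  have "summable (\<lambda>n. real n powr (- Re s))"
    using assms by (subst summable_real_powr_iff) auto
  then have "summable (\<lambda>n. real (Suc n) powr (- Re s))"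
    by (subst summable_Suc_iff)
  then have "summable (\<lambda>n. norm (of_nat (Suc n) powr (- s) :: complex))"
    by (simp add: norm_Suc_powr del: of_nat_Suc)
  then have "summable (\<lambda>n. of_nat (Suc n) powr (- s) :: complex)"
    by (rule summable_norm_cancel)
  then show ?thesis unfolding zeta_series_def by (rule summable_sums)
qed

lemma zeta_series_holomorphic: "zeta_series holomorphic_on {s. Re s > 1}"
  unfolding zeta_series_def
  by (rule holomorphic_dirichlet_type_series[where K = "\<lambda>_. 1" and m = 0])
     (auto simp: norm_Suc_powr simp del: of_nat_Suc intro!: holomorphic_intros)

definition falling :: "nat \<Rightarrow> complex \<Rightarrow> complex" where
  "falling i s = (\<Prod>j<i. 1 - s - of_nat j)"

lemma falling_Suc: "falling (Suc i) s = falling i s * (1 - s - of_nat i)"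
  by (simp add: falling_def)

lemma falling_0 [simp]: "falling 0 s = 1"
  by (simp add: falling_def)

lemma falling_holomorphic [holomorphic_intros]: "falling i holomorphic_on A"
  unfolding falling_def by (intro holomorphic_intros)

definition taylor_rem :: "nat \<Rightarrow> nat \<Rightarrow> complex \<Rightarrow> complex" where
  "taylor_rem m n s = of_nat (Suc (Suc n)) powr (1 - s) -
     (\<Sum>i\<le>m. falling i s * of_nat (Suc n) powr (1 - s - of_nat i) / fact i)"

lemma taylor_rem_bound:
  assumes "Re s + real m \<ge> 0"
  shows "norm (taylor_rem m n s) \<le>
    norm (falling (Suc m) s) / fact m * real (Suc n) powr (- Re s - real m)"
proof -
  define S where "S = closed_segment (of_nat (Suc n)) (of_nat (Suc (Suc n)) :: complex)"
  define f where "f = (\<lambda>i x. falling i s * x powr (1 - s - of_nat i))"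
  have S: "\<exists>y. x = of_real y \<and> y \<ge> real (Suc n)" if "x \<in> S" for x
  proof -
    obtain v where v: "0 \<le> v" "x = (1 - of_real v) * of_nat (Suc n) + of_real v * of_nat (Suc (Suc n))"
      using \<open>x \<in> S\<close> unfolding S_def closed_segment_def by (auto simp: scaleR_conv_of_real)
    then have "x = of_real (real (Suc n) + v)"
      by (simp add: algebra_simps)
    with v(1) show ?thesis by (intro exI[of _ "real (Suc n) + v"]) auto
  qed
  have "norm (f 0 (of_nat (Suc (Suc n))) -
      (\<Sum>i\<le>m. f i (of_nat (Suc n)) * (of_nat (Suc (Suc n)) - of_nat (Suc n)) ^ i / fact i)) \<le>
      norm (falling (Suc m) s) * real (Suc n) powr (- Re s - real m) *
        norm (of_nat (Suc (Suc n)) - of_nat (Suc n) :: complex) ^ Suc m / fact m"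
  proof (rule complex_Taylor)
    show "convex S" by (simp add: S_def)
    show "of_nat (Suc n) \<in> S" "of_nat (Suc (Suc n)) \<in> S" by (simp_all add: S_def)
    show "(f i has_field_derivative f (Suc i) x) (at x within S)" if xS: "x \<in> S" for i x
    proof -
      obtain y where y: "x = of_real y" "y \<ge> real (Suc n)" using S[OF xS] by blast
      then have nz: "x \<notin> \<real>\<^sub>\<le>\<^sub>0" by simp
      have "1 - s - of_nat i - 1 = 1 - s - of_nat (Suc i)" by simp
      then show ?thesis
        unfolding f_def falling_Suc
        by (auto intro!: derivative_eq_intros nz)
    qed
    show "norm (f (Suc m) x) \<le> norm (falling (Suc m) s) * real (Suc n) powr (- Re s - real m)"
      if xS: "x \<in> S" for x
    proof -
      obtain y where y: "x = of_real y" "y \<ge> real (Suc n)" using S[OF xS] by blast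
      have "norm (x powr (1 - s - of_nat (Suc m))) = y powr (- Re s - real m)"
        using y by (simp add: norm_powr_real_powr)
      also have "\<dots> \<le> real (Suc n) powr (- Re s - real m)"
        using assms y by (intro powr_mono2') auto
      finally show ?thesis
        unfolding f_def by (simp add: norm_mult mult_left_mono)
    qed
  qed
  then show ?thesis
    by (simp add: taylor_rem_def f_def del: of_nat_Suc) (simp add: field_simps)
qed

lemma taylor_rem_series_holomorphic:
  assumes "m \<ge> 1"
  shows "(\<lambda>s. \<Sum>n. taylor_rem m n s) holomorphic_on {s. Re s > 1 - real m}"
proof (rule holomorphic_dirichlet_type_series
    [where K = "\<lambda>s. norm (falling (Suc m) s) / fact m" and m = "real m"])
  show "taylor_rem m n holomorphic_on {s. Re s > 1 - real m}" for n
    unfolding taylor_rem_def by (auto intro!: holomorphic_intros simp del: of_nat_Suc)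
  show "continuous_on UNIV (\<lambda>s. norm (falling (Suc m) s) / fact m)"
    by (intro continuous_intros holomorphic_on_imp_continuous_on holomorphic_intros) auto
  show "norm (taylor_rem m n s) \<le>
      norm (falling (Suc m) s) / fact m * real (Suc n) powr (- Re s - real m)"
    if "Re s > 1 - real m" for n s
    using that by (intro taylor_rem_bound) auto
qed auto

lemma taylor_rem_series:
  assumes s: "Re s > 1"
  shows "(\<Sum>n. taylor_rem m n s) =
    - 1 + (\<Sum>i<m. falling i s / fact (Suc i) * ((s + of_nat i - 1) * zeta_series (s + of_nat i)))"
proof -
  have "(\<lambda>n. of_nat (Suc n) powr (1 - s) :: complex) \<longlonglongrightarrow> 0"
  proof (rule tendsto_norm_zero_cancel)
    have "(\<lambda>n. real (Suc n) powr (1 - Re s)) \<longlonglongrightarrow> 0"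
      using s by (intro tendsto_neg_powr filterlim_compose[OF filterlim_real_sequentially filterlim_Suc]) auto
    then show "(\<lambda>n. norm (of_nat (Suc n) powr (1 - s) :: complex)) \<longlonglongrightarrow> 0"
      by (simp add: norm_Suc_powr del: of_nat_Suc)
  qed
  from telescope_sums[OF this]
  have tele: "(\<lambda>n. of_nat (Suc (Suc n)) powr (1 - s) - of_nat (Suc n) powr (1 - s)) sums (- 1 :: complex)"
    by simp
  have "(\<lambda>n. \<Sum>i<m. falling (Suc i) s / fact (Suc i) * of_nat (Suc n) powr (- (s + of_nat i)))
     sums (\<Sum>i<m. falling (Suc i) s / fact (Suc i) * zeta_series (s + of_nat i))"
    using s by (intro sums_sum sums_mult zeta_series_sums) auto
  from sums_diff[OF tele this]
  have "(\<lambda>n. taylor_rem m n s) sums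
     (- 1 - (\<Sum>i<m. falling (Suc i) s / fact (Suc i) * zeta_series (s + of_nat i)))"
  proof (rule sums_cong[THEN iffD1, rotated])
    fix n
    have "(\<Sum>i\<le>m. falling i s * of_nat (Suc n) powr (1 - s - of_nat i) / fact i) =
      of_nat (Suc n) powr (1 - s) +
      (\<Sum>i<m. falling (Suc i) s / fact (Suc i) * of_nat (Suc n) powr (- (s + of_nat i)))"
      unfolding lessThan_Suc_atMost[symmetric]
      by (subst sum.lessThan_Suc_shift) (simp add: algebra_simps del: fact_Suc)
    then show "of_nat (Suc (Suc n)) powr (1 - s) - of_nat (Suc n) powr (1 - s) -
        (\<Sum>i<m. falling (Suc i) s / fact (Suc i) * of_nat (Suc n) powr (- (s + of_nat i))) =
        taylor_rem m n s"
      unfolding taylor_rem_def by simp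
  qed
  then have "(\<Sum>n. taylor_rem m n s) =
      - 1 - (\<Sum>i<m. falling (Suc i) s / fact (Suc i) * zeta_series (s + of_nat i))"
    by (rule sums_unique[symmetric])
  also have "\<dots> = - 1 + (\<Sum>i<m. - (falling (Suc i) s / fact (Suc i) * zeta_series (s + of_nat i)))"
    by (simp add: sum_negf)
  also have "(\<Sum>i<m. - (falling (Suc i) s / fact (Suc i) * zeta_series (s + of_nat i))) =
      (\<Sum>i<m. falling i s / fact (Suc i) * ((s + of_nat i - 1) * zeta_series (s + of_nat i)))"
  proof (rule sum.cong)
    fix i
    have "1 - s - of_nat i = - (s + of_nat i - 1)" by simp
    then show "- (falling (Suc i) s / fact (Suc i) * zeta_series (s + of_nat i)) =
        falling i s / fact (Suc i) * ((s + of_nat i - 1) * zeta_series (s + of_nat i))"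
      unfolding falling_Suc by (simp only: mult_minus_right mult_minus_left divide_minus_left minus_minus
          times_divide_eq_left mult.assoc)
  qed simp
  finally show ?thesis .
qed

lemma zeta_continuation_halfplane:
  "\<exists>g. g holomorphic_on {s. Re s > 1 - real k} \<and>
       (\<forall>s. Re s > 1 \<longrightarrow> g s = (s - 1) * zeta_series s)"
proof (induction k)
  case 0
  have "(\<lambda>s. (s - 1) * zeta_series s) holomorphic_on {s. Re s > 1}"
    by (intro holomorphic_intros zeta_series_holomorphic)
  then show ?case by auto
next
  case (Suc k)
  then obtain g where g: "g holomorphic_on {s. Re s > 1 - real k}"
    and g_eq: "\<And>s. Re s > 1 \<Longrightarrow> g s = (s - 1) * zeta_series s" by blast
  define h where "h = (\<lambda>s. 1 + (\<Sum>n. taylor_rem (Suc k) n s) -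
    (\<Sum>i<k. falling (Suc i) s / fact (Suc (Suc i)) * g (s + of_nat (Suc i))))"
  have shift: "(\<lambda>s. g (s + of_nat (Suc i))) holomorphic_on {s. Re s > 1 - real (Suc k)}" for i
  proof -
    have "(g \<circ> (\<lambda>s. s + of_nat (Suc i))) holomorphic_on {s. Re s > 1 - real (Suc k)}"
      by (rule holomorphic_on_compose_gen[OF _ g]) (auto intro!: holomorphic_intros)
    then show ?thesis by (simp add: o_def)
  qed
  have "h holomorphic_on {s. Re s > 1 - real (Suc k)}"
    unfolding h_def
    by (intro holomorphic_intros shift taylor_rem_series_holomorphic) (auto simp del: fact_Suc)
  moreover have "h s = (s - 1) * zeta_series s" if s: "Re s > 1" for s
  proof -
    have "(\<Sum>i<k. falling (Suc i) s / fact (Suc (Suc i)) * g (s + of_nat (Suc i))) =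
      (\<Sum>i<k. falling (Suc i) s / fact (Suc (Suc i)) *
         ((s + of_nat (Suc i) - 1) * zeta_series (s + of_nat (Suc i))))"
      using s by (intro sum.cong) (auto simp: g_eq)
    then show ?thesis
      unfolding h_def taylor_rem_series[OF s] by (subst sum.lessThan_Suc_shift) simp
  qed
  ultimately show ?case by blast
qed

lemma riemann_zeta_exists:
  "\<exists>f. f holomorphic_on - {1} \<and>
     (\<forall>s. Re s > 1 \<longrightarrow> f s = (\<Sum>n. of_nat (Suc n) powr (- s)))"
proof -
  define H where "H = (\<lambda>k::nat. {s. Re s > 1 - real k})"
  obtain g where g: "\<And>k. g k holomorphic_on H k"
    and g_eq: "\<And>k s. Re s > 1 \<Longrightarrow> g k s = (s - 1) * zeta_series s"
  proof -
    have "\<forall>k. \<exists>g. g holomorphic_on H k \<and>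
        (\<forall>s. Re s > 1 \<longrightarrow> g s = (s - 1) * zeta_series s)"
      unfolding H_def by (intro allI zeta_continuation_halfplane)
    from choice[OF this] show ?thesis using that by blast
  qed
  have H_open: "open (H k)" for k unfolding H_def by (rule open_halfspace_Re_gt)
  have agree: "g k s = g l s" if "k \<le> l" "s \<in> H k" for k l s
  proof (rule analytic_continuation_open[of "H 0" "H k" "g k" "g l"])
    show "open (H 0)" "open (H k)" by (rule H_open)+
    show "H 0 \<noteq> {}" unfolding H_def by (auto intro!: exI[of _ 2])
    show "connected (H k)"
      unfolding H_def by (intro convex_connected convex_halfspace_Re_gt)
    show "H 0 \<subseteq> H k" unfolding H_def by auto
    show "g k holomorphic_on H k" by (rule g)
    show "g l holomorphic_on H k"
      by (rule holomorphic_on_subset[OF g]) (use that in \<open>auto simp: H_def\<close>)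
    show "g k z = g l z" if "z \<in> H 0" for z using that by (simp add: H_def g_eq)
    show "s \<in> H k" by fact
  qed
  define N where "N = (\<lambda>s. nat \<lceil>2 - Re s\<rceil>)"
  have N: "s \<in> H (N s)" for s
  proof -
    have "2 - Re s \<le> real (nat \<lceil>2 - Re s\<rceil>)" by (rule real_nat_ceiling_ge)
    then show ?thesis unfolding N_def H_def by simp
  qed
  define Z where "Z = (\<lambda>s. g (N s) s)"
  have Z_eq: "Z s = g k s" if "s \<in> H k" for s k
    unfolding Z_def using agree[of k "N s" s] agree[of "N s" k s] N[of s] that
    by (metis nle_le)
  have Z_hol: "Z holomorphic_on UNIV"
  proof -
    have "Z holomorphic_on H k" for k
      by (rule holomorphic_transform[OF g]) (simp add: Z_eq)
    then have "Z holomorphic_on (\<Union>k. H k)"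
      by (intro holomorphic_on_UN_open H_open)
    moreover have "(\<Union>k. H k) = UNIV" using N by blast
    ultimately show ?thesis by simp
  qed
  have "(\<lambda>s. Z s / (s - 1)) holomorphic_on - {1}"
    by (intro holomorphic_intros holomorphic_on_subset[OF Z_hol]) auto
  moreover have "Z s / (s - 1) = (\<Sum>n. of_nat (Suc n) powr (- s))" if "Re s > 1" for s
  proof -
    have "Z s = (s - 1) * zeta_series s" using that by (simp add: Z_def g_eq)
    moreover have "s \<noteq> 1" using that by auto
    ultimately show ?thesis by (simp add: zeta_series_def)
  qed
  ultimately show ?thesis by blast
qed

lemma riemann_zeta_holomorphic: "riemann_zeta holomorphic_on - {1}"
  and riemann_zeta_eq_series: "Re s > 1 \<Longrightarrow> riemann_zeta s = (\<Sum>n. of_nat (Suc n) powr (- s))"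
  using someI_ex[OF riemann_zeta_exists] unfolding riemann_zeta_def[symmetric] by blast+

end

theory Submission
  imports Defs
begin

text \<open>
  For \<open>Re s > 1\<close> the function \<open>zeta_deriv k\<close> is, up to sign, the Dirichlet series with terms
  \<open>(ln n)^k n^(-s)\<close>. The terms for \<open>n\<close> and \<open>n + 1\<close> have equal modulus on the line \<open>Re s = q n * k\<close>, and
  their quotient is below \<open>1/3\<close> at distance \<open>(n + 1) * ln 3\<close> from that line. In the strip of \<open>M\<close> the
  terms below \<open>M\<close> therefore increase at least geometrically with ratio \<open>3\<close>, so they sum to at most half
  of the \<open>M\<close>-th term. The terms above \<open>M + 1\<close> sum to at most half of the \<open>(M + 1)\<close>-st one; they do not
  decay geometrically, and the bound uses that the gap hypothesis forces \<open>k\<close> to be large.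

  On the boundary of a rectangle the sum of the \<open>M\<close>-th and \<open>(M + 1)\<close>-st terms exceeds half the sum of their
  moduli: on the vertical sides one is more than three times the other, on the horizontal sides they
  have the same argument. Rouche's theorem then compares \<open>zeta_deriv k\<close> with the sum of these two terms,
  whose only zero in the rectangle is the simple one at its centre.
\<close>

subsection \<open>The critical lines\<close>

lemma q_eq: "q n = (ln (ln (real (n + 1))) - ln (ln (real n))) / (ln (real (n + 1)) - ln (real n))"
  if "n \<ge> 2"
proof -
  have "ln (ln (real n) / ln (real (n + 1))) = - (ln (ln (real (n + 1))) - ln (ln (real n)))"
    using that by (simp add: ln_div)
  moreover have "ln (real n / real (n + 1)) = - (ln (real (n + 1)) - ln (real n))"
    using that by (simp add: ln_div)
  ultimately show ?thesis
    unfolding q_def by (simp only: minus_divide_divide)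
qed

text \<open>\<open>q n\<close> is the mean of 1/x over the interval from ln n to ln (n + 1).
  Rescaling that interval to {0..1} lets the integrands for different \<open>n\<close> be compared
  pointwise.\<close>

lemma q_has_integral:
  assumes "n \<ge> 2"
  shows "((\<lambda>v. inverse ((1 - v) * ln (real n) + v * ln (real (n + 1)))) has_integral q n) {0..1}"
proof -
  define a b where "a = ln (real n)" and "b = ln (real (n + 1))"
  have ab: "0 < a" "a < b" using assms by (auto simp: a_def b_def)
  have "((\<lambda>v. inverse ((1 - v) * a + v * b)) has_integral
      ln ((1 - 1) * a + 1 * b) / (b - a) - ln ((1 - 0) * a + 0 * b) / (b - a)) {0..1}"
  proof (rule fundamental_theorem_of_calculus)
    fix v :: real assume v: "v \<in> {0..1}"
    have "(1 - v) * a + v * b = a + v * (b - a)" by (simp add: algebra_simps)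
    moreover have "0 \<le> v * (b - a)" using v ab by simp
    ultimately have "0 < (1 - v) * a + v * b" using ab by linarith
    then have "((\<lambda>v. ln ((1 - v) * a + v * b) / (b - a)) has_real_derivative
        inverse ((1 - v) * a + v * b)) (at v within {0..1})"
      using ab by (auto intro!: derivative_eq_intros simp: divide_simps)
    then show "((\<lambda>v. ln ((1 - v) * a + v * b) / (b - a)) has_vector_derivative
        inverse ((1 - v) * a + v * b)) (at v within {0..1})"
      by (simp add: has_real_derivative_iff_has_vector_derivative)
  qed simp
  then show ?thesis
    by (simp add: q_eq[OF assms] a_def b_def diff_divide_distrib)
qed

lemma ln_Suc_concave:
  assumes "n \<ge> 1"
  shows "ln (real n) + ln (real (n + 2)) \<le> 2 * ln (real (n + 1))"
proof -
  have "ln (real n) + ln (real (n + 2)) = ln (real n * real (n + 2))"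
    using assms by (simp add: ln_mult)
  also have "\<dots> \<le> ln (real (n + 1) ^ 2)"
    using assms by (intro ln_mono) (auto simp: power2_eq_square algebra_simps intro!: add_pos_pos)
  also have "\<dots> = 2 * ln (real (n + 1))" by (subst ln_realpow) auto
  finally show ?thesis .
qed

text \<open>For each \<open>v\<close> the integrand of \<open>q_has_integral\<close> is the reciprocal of a positive concave
  function of \<open>n\<close>, hence convex in \<open>n\<close>.\<close>
lemma q_convex:
  assumes "n \<ge> 2"
  shows "2 * q (n + 1) \<le> q n + q (n + 2)"
proof (rule has_integral_le)
  show "((\<lambda>v. 2 * inverse ((1 - v) * ln (real (n + 1)) + v * ln (real (n + 1 + 1)))) has_integral
      2 * q (n + 1)) {0..1}"
    using assms by (intro has_integral_mult_right q_has_integral) auto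
  show "((\<lambda>v. inverse ((1 - v) * ln (real n) + v * ln (real (n + 1))) +
      inverse ((1 - v) * ln (real (n + 2)) + v * ln (real (n + 2 + 1)))) has_integral
      q n + q (n + 2)) {0..1}"
    using assms by (intro has_integral_add q_has_integral) auto
next
  fix v :: real assume "v \<in> {0..1}"
  then have v: "0 \<le> v" "v \<le> 1" by auto
  define g where "g = (\<lambda>n::nat. (1 - v) * ln (real n) + v * ln (real (n + 1)))"
  have pos: "g m > 0" if "m \<ge> 2" for m
  proof -
    have "g m = ln (real m) + v * (ln (real (m + 1)) - ln (real m))"
      by (simp add: g_def algebra_simps)
    moreover have "0 \<le> v * (ln (real (m + 1)) - ln (real m))" using v that by simp
    ultimately show ?thesis using that by (simp add: add_pos_nonneg)
  qed
  have "(1 - v) * (ln (real n) + ln (real (n + 2))) \<le> (1 - v) * (2 * ln (real (n + 1)))"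
    using v assms by (intro mult_left_mono ln_Suc_concave) auto
  moreover have "v * (ln (real (n + 1)) + ln (real (n + 1 + 2))) \<le> v * (2 * ln (real (n + 1 + 1)))"
    using v assms by (intro mult_left_mono ln_Suc_concave) auto
  ultimately have conc: "g n + g (n + 2) \<le> 2 * g (n + 1)"
    by (simp add: g_def algebra_simps)
  have p: "g n > 0" "g (n + 1) > 0" "g (n + 2) > 0" using assms by (auto intro!: pos)
  \<comment> \<open>Concavity bounds \<open>g (n + 1)\<close> below by the mean of its neighbours;
    the inequality between harmonic and arithmetic mean then separates the two reciprocals.\<close>
  have "2 * inverse (g (n + 1)) \<le> 4 / (g n + g (n + 2))"
    using conc p by (simp add: field_simps)
  also have "\<dots> \<le> inverse (g n) + inverse (g (n + 2))"
  proof -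
    have "4 * (g n * g (n + 2)) \<le> (g n + g (n + 2)) * (g n + g (n + 2))"
      using zero_le_square[of "g n - g (n + 2)"] by (simp add: algebra_simps)
    then show ?thesis using p by (simp add: field_simps)
  qed
  finally show "2 * inverse ((1 - v) * ln (real (n + 1)) + v * ln (real (n + 1 + 1))) \<le>
      inverse ((1 - v) * ln (real n) + v * ln (real (n + 1))) +
      inverse ((1 - v) * ln (real (n + 2)) + v * ln (real (n + 2 + 1)))"
    by (simp add: g_def)
qed

text \<open>Midpoint and trapezoid bounds for the mean of the convex function 1/x that
  \<open>q n\<close> represents.\<close>

lemma
  assumes "n \<ge> 2"
  shows q_ge: "2 / (ln (real n) + ln (real (n + 1))) \<le> q n"
    and q_le_trapezoid: "q n \<le> (1 / ln (real n) + 1 / ln (real (n + 1))) / 2"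
proof -
  define a b where "a = ln (real n)" and "b = ln (real (n + 1))"
  have ab: "0 < a" "a < b" using assms by (auto simp: a_def b_def)
  show "2 / (ln (real n) + ln (real (n + 1))) \<le> q n"
    using ln_inverse_approx_ge[of a b] ab unfolding q_eq[OF assms] a_def[symmetric] b_def[symmetric]
    by (simp add: field_simps)
  show "q n \<le> (1 / ln (real n) + 1 / ln (real (n + 1))) / 2"
    using ln_inverse_approx_le[of a "b - a"] ab
    unfolding q_eq[OF assms] a_def[symmetric] b_def[symmetric]
    by (simp add: pos_divide_le_eq inverse_eq_divide mult.commute)
qed

lemma q_le_inverse_ln: "q n \<le> 1 / ln (real n)" if "n \<ge> 2"
proof -
  have "1 / ln (real (n + 1)) \<le> 1 / ln (real n)"
    using that by (intro divide_left_mono) auto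
  moreover have "(x + y) / 2 \<le> x" if "y \<le> x" for x y :: real using that by simp
  ultimately show ?thesis using q_le_trapezoid[OF \<open>n \<ge> 2\<close>] order_trans by blast
qed

lemma q_ge_inverse_ln: "1 / ln (real (n + 1)) \<le> q n" if "n \<ge> 2"
proof -
  have "1 / ln (real (n + 1)) \<le> 2 / (ln (real n) + ln (real (n + 1)))"
    using that by (simp add: field_simps add_pos_pos)
  then show ?thesis using q_ge[OF that] by linarith
qed

lemma q_nonneg: "0 \<le> q n" if "n \<ge> 2"
  by (rule order_trans[OF _ q_ge_inverse_ln[OF that]]) simp

lemma q_antimono_Suc: "q (n + 1) \<le> q n" if "n \<ge> 2"
  using q_le_inverse_ln[of "n + 1"] q_ge_inverse_ln[OF that] that by linarith

lemma q_antimono: "q n \<le> q m" if "2 \<le> m" "m \<le> n"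
  using that(2,1)
proof (induction n rule: dec_induct)
  case (step n)
  then show ?case using q_antimono_Suc[of n] by simp
qed simp

section \<open>Explicit numerical bounds for logarithms\<close>

lemma ln_3_bounds: "ln (3::real) \<ge> 1.095" "ln (3::real) \<le> 1.1"
  using ln_approx_bounds[of 3 3] by (auto simp: eval_nat_numeral)

lemma ln_2_bounds: "ln (2::real) \<ge> 0.69" "ln (2::real) \<le> 0.694"
  using ln_approx_bounds[of 2 2] by (auto simp: eval_nat_numeral)

lemma ln_5_3_le: "ln (5/3::real) \<le> 0.55"
  using ln_approx_bounds[of "5/3" 2] by (auto simp: eval_nat_numeral)

subsection \<open>Bounds for the moduli of the terms\<close>

text \<open>The derivative at \<open>t\<close> is the integral of 1/x over the interval from t - c
  to t + c minus its trapezoid bound, and the trapezoid rule overestimates for a convex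
  integrand.\<close>

lemma ln_ratio_scaled_antimono:
  fixes c x y :: real
  assumes "0 < c" "c < x" "x \<le> y"
  shows "y * (ln (y + c) - ln (y - c)) \<le> x * (ln (x + c) - ln (x - c))"
proof (rule DERIV_nonpos_imp_nonincreasing[OF assms(3)])
  fix t assume t: "x \<le> t" "t \<le> y"
  then have tc: "0 < t - c" "0 < t + c" using assms by auto
  have "ln (t - c + 2 * c) - ln (t - c) \<le> 2 * c * (inverse (t - c) + inverse (t - c + 2 * c)) / 2"
    using tc assms by (intro ln_inverse_approx_le) auto
  moreover have "2 * c * (inverse (t - c) + inverse (t - c + 2 * c)) / 2 =
      - (t * (1 / (t + c) - 1 / (t - c)))"
    using tc by (simp add: divide_simps)
  ultimately have "(ln (t + c) - ln (t - c)) + t * (1 / (t + c) - 1 / (t - c)) \<le> 0"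
    by (simp add: add.commute)
  moreover have "((\<lambda>y. y * (ln (y + c) - ln (y - c))) has_real_derivative
      (ln (t + c) - ln (t - c)) + t * (1 / (t + c) - 1 / (t - c))) (at t)"
    using tc by (auto intro!: derivative_eq_intros simp: algebra_simps)
  ultimately show "\<exists>D. ((\<lambda>y. y * (ln (y + c) - ln (y - c))) has_real_derivative D) (at t) \<and> D \<le> 0"
    by blast
qed

text \<open>In logarithms the claim reads ln ((n + 1 + N/2) / (n - N/2)) \<le> \<beta> * ln ((n + 1)
  / n). With y = 2 * n + 1 the right side is at least 2 * \<beta> / y by the midpoint bound, and y
  times the left side decreases in y. The worst case is thus n = N, where y / 2 = N + 1/2 and the
  quotient is (3 * N + 2) / N; this is the threshold for \<beta>.\<close>

lemma power_ratio_le: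
  fixes n N \<beta> :: real
  assumes N: "N \<ge> 1" "N \<le> n" and \<beta>: "(N + 1/2) * ln ((3 * N + 2) / N) \<le> \<beta>"
  shows "(n / (n + 1)) powr \<beta> \<le> (n - N / 2) / (n + 1 + N / 2)"
proof -
  define y where "y = 2 * n + 1"
  define l where "l = ln ((3 * N + 2) / N)"
  have l: "l \<ge> 0" unfolding l_def using N by (intro ln_ge_zero) (simp add: field_simps)
  have "y * (ln (y + (N + 1)) - ln (y - (N + 1))) \<le>
      (2 * N + 1) * (ln (2 * N + 1 + (N + 1)) - ln (2 * N + 1 - (N + 1)))"
    unfolding y_def using N by (intro ln_ratio_scaled_antimono) auto
  also have "ln (2 * N + 1 + (N + 1)) - ln (2 * N + 1 - (N + 1)) = l"
    unfolding l_def using N by (simp add: ln_div algebra_simps)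
  also have "ln (y + (N + 1)) - ln (y - (N + 1)) = ln ((y + (N + 1)) / (y - (N + 1)))"
    unfolding y_def using N by (subst ln_div) auto
  also have "(y + (N + 1)) / (y - (N + 1)) = (n + 1 + N / 2) / (n - N / 2)"
    unfolding y_def using N by (simp add: field_simps)
  finally have "ln ((n + 1 + N / 2) / (n - N / 2)) \<le> (N + 1/2) * l * (2 / y)"
    using N unfolding y_def by (simp add: field_simps)
  also have "\<dots> \<le> \<beta> * (ln (n + 1) - ln n)"
  proof (rule mult_mono)
    show "2 / y \<le> ln (n + 1) - ln n"
      using ln_inverse_approx_ge[of n "n + 1"] N by (simp add: y_def add.commute)
    have "0 \<le> (N + 1/2) * l" using l N by (intro mult_nonneg_nonneg) auto
    then show "0 \<le> \<beta>" using \<beta> unfolding l_def by linarith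
  qed (use \<beta> N in \<open>auto simp: l_def y_def\<close>)
  finally have "\<beta> * ln (n / (n + 1)) \<le> - ln ((n + 1 + N / 2) / (n - N / 2))"
    using N by (simp add: ln_div algebra_simps)
  also have "\<dots> = ln ((n - N / 2) / (n + 1 + N / 2))"
    using N by (simp add: ln_div)
  finally have "exp (\<beta> * ln (n / (n + 1))) \<le> exp (ln ((n - N / 2) / (n + 1 + N / 2)))"
    by simp
  then show ?thesis using N by (simp add: powr_def)
qed

text \<open>The modulus of the \<open>n\<close>-th term of the series on the line Re s = \<sigma>.
  It is 0 at n = 0 because \<open>0 powr x = 0\<close>.\<close>

definition log_pow_term :: "nat \<Rightarrow> real \<Rightarrow> nat \<Rightarrow> real" where
  "log_pow_term k \<sigma> n = ln (real n) ^ k * real n powr (- \<sigma>)"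

lemma log_pow_term_nonneg: "0 \<le> log_pow_term k \<sigma> n"
  by (cases n) (auto simp: log_pow_term_def)

lemma log_pow_term_pos: "n \<ge> 2 \<Longrightarrow> 0 < log_pow_term k \<sigma> n"
  by (auto simp: log_pow_term_def)

text \<open>By definition of \<open>q n\<close>, ln b - ln a = q n * (b - a) for a = ln n and b = ln
  (n + 1), so \<sigma> = q n * k is exactly where the two terms balance.\<close>

lemma log_pow_term_Suc:
  assumes "n \<ge> 2"
  shows "log_pow_term k \<sigma> (n + 1) = log_pow_term k \<sigma> n * (real n / real (n + 1)) powr (\<sigma> - q n * k)"
proof -
  define a b where "a = ln (real n)" and "b = ln (real (n + 1))"
  have ab: "0 < a" "a < b" using assms by (auto simp: a_def b_def)
  have *: "log_pow_term k \<sigma> n = exp (k * ln a - \<sigma> * a)" 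
    using ab assms by (simp add: log_pow_term_def powr_def exp_diff exp_minus exp_of_nat_mult a_def
        divide_inverse)
  have **: "log_pow_term k \<sigma> (n + 1) = exp (k * ln b - \<sigma> * b)"
    using ab assms by (simp add: log_pow_term_def powr_def exp_diff exp_minus exp_of_nat_mult b_def
        divide_inverse)
  have "q n * (b - a) = ln b - ln a"
    using ab unfolding q_eq[OF assms] a_def[symmetric] b_def[symmetric] by simp
  then have "(\<sigma> - q n * k) * (a - b) = \<sigma> * (a - b) + k * (ln b - ln a)"
    by (simp only: flip: \<open>q n * (b - a) = _\<close>) (simp add: algebra_simps)
  then have "k * ln b - \<sigma> * b = k * ln a - \<sigma> * a + (\<sigma> - q n * k) * (a - b)"
    by (simp add: algebra_simps)
  moreover have "(real n / real (n + 1)) powr (\<sigma> - q n * k) = exp ((\<sigma> - q n * k) * (a - b))"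
    using assms by (simp add: powr_def ln_div a_def b_def)
  ultimately show ?thesis unfolding * ** by (simp add: exp_add)
qed

text \<open>This fixes the half-width (n + 1) * ln 3 of the strips: ln ((n + 1) / n) \<ge> 2 / (2 *
  n + 1) > 1 / (n + 1).\<close>

lemma ratio_powr_less_third:
  assumes "n \<ge> 1"
  shows "(real n / real (n + 1)) powr (real (n + 1) * ln 3) < 1 / 3"
proof -
  have "ln (real n / real (n + 1)) < - 1 / real (n + 1)"
  proof -
    have "ln (real (n + 1)) - ln (real n) \<ge> 2 * (real (n + 1) - real n) / (real n + real (n + 1))"
      using assms by (intro ln_inverse_approx_ge) auto
    moreover have "2 * (real (n + 1) - real n) / (real n + real (n + 1)) > 1 / real (n + 1)"
      using assms by (simp add: field_simps)
    ultimately show ?thesis using assms by (simp add: ln_div)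
  qed
  then have "real (n + 1) * ln 3 * ln (real n / real (n + 1)) <
      real (n + 1) * ln 3 * (- 1 / real (n + 1))"
    by (intro mult_strict_left_mono) auto
  also have "\<dots> = - ln 3" by simp
  finally have "exp (real (n + 1) * ln 3 * ln (real n / real (n + 1))) < exp (- ln 3)"
    by (simp only: exp_less_mono)
  then show ?thesis using assms by (simp add: powr_def exp_minus inverse_eq_divide)
qed

lemma log_pow_term_right:
  assumes "n \<ge> 2" "q n * real k + real (n + 1) * ln 3 \<le> \<sigma>"
  shows "log_pow_term k \<sigma> (n + 1) < log_pow_term k \<sigma> n / 3"
proof -
  have "(real n / real (n + 1)) powr (\<sigma> - q n * k) \<le> (real n / real (n + 1)) powr (real (n + 1) * ln 3)"
    using assms by (intro powr_mono') auto
  also have "\<dots> < 1 / 3" using assms by (intro ratio_powr_less_third) auto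
  finally show ?thesis
    using log_pow_term_pos[OF assms(1), of k \<sigma>] unfolding log_pow_term_Suc[OF assms(1)]
    by (simp add: mult_strict_left_mono)
qed

lemma log_pow_term_left:
  assumes "n \<ge> 2" "\<sigma> \<le> q n * real k - real (n + 1) * ln 3"
  shows "log_pow_term k \<sigma> n < log_pow_term k \<sigma> (n + 1) / 3"
proof -
  define r where "r = real n / real (n + 1)"
  have r: "0 < r" "r \<le> 1" using assms by (auto simp: r_def)
  have "r powr (q n * k - \<sigma>) \<le> r powr (real (n + 1) * ln 3)"
    using assms r by (intro powr_mono') auto
  also have "\<dots> < 1 / 3" unfolding r_def using assms by (intro ratio_powr_less_third) auto
  finally have "r powr (q n * k - \<sigma>) < 1 / 3" .
  moreover have "log_pow_term k \<sigma> n = log_pow_term k \<sigma> (n + 1) * r powr (q n * k - \<sigma>)"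
    using r unfolding log_pow_term_Suc[OF assms(1)] r_def[symmetric]
    by (simp add: mult.assoc flip: powr_add)
  ultimately show ?thesis
    using log_pow_term_pos[of "n + 1" k \<sigma>] assms(1)
    by (simp add: mult_strict_left_mono)
qed

text \<open>The bound reproduces itself: adding the term at \<open>m\<close> gives at most 3/2 of
  that term, which is below half of the next one by the factor 3 in
  \<open>log_pow_term_left\<close>.\<close>

lemma sum_log_pow_term_head:
  assumes "m \<ge> 2" "\<And>n. 2 \<le> n \<Longrightarrow> n < m \<Longrightarrow> \<sigma> \<le> q n * real k - real (n + 1) * ln 3"
  shows "(\<Sum>n=2..<m. log_pow_term k \<sigma> n) \<le> log_pow_term k \<sigma> m / 2"
  using assms
proof (induction m rule: dec_induct)
  case base
  then show ?case using log_pow_term_nonneg[of k \<sigma> 2] by simp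
next
  case (step m)
  then have "log_pow_term k \<sigma> m < log_pow_term k \<sigma> (m + 1) / 3"
    by (intro log_pow_term_left) auto
  moreover have "(\<Sum>n=2..<m. log_pow_term k \<sigma> n) \<le> log_pow_term k \<sigma> m / 2"
    using step by auto
  ultimately show ?case using step.hyps by simp
qed

text \<open>Since q n \<le> 1 / ln N for all n \<ge> N, a single exponent serves the whole
  tail.\<close>

lemma log_pow_term_Suc_le:
  assumes "2 \<le> N" "N \<le> n"
  shows "log_pow_term k \<sigma> (n + 1) \<le>
    log_pow_term k \<sigma> n * (real n / real (n + 1)) powr (\<sigma> - real k / ln (real N))"
proof -
  have "q n \<le> 1 / ln (real n)" using assms by (intro q_le_inverse_ln) auto
  also have "\<dots> \<le> 1 / ln (real N)" using assms by (intro divide_left_mono) auto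
  finally have "q n * k \<le> k / ln (real N)"
    using mult_right_mono[of "q n" "1 / ln (real N)" "real k"] by simp
  then show ?thesis
    using assms log_pow_term_nonneg[of k \<sigma> n]
    by (subst log_pow_term_Suc) (auto intro!: mult_left_mono powr_mono')
qed

text \<open>The bound telescopes: the sequence \<open>T n = (n + N / 2) / N * log_pow_term k \<sigma> n\<close> satisfies
  \<open>log_pow_term k \<sigma> n \<le> T n - T (n + 1)\<close> by \<open>power_ratio_le\<close>, and \<open>T N\<close> is the right-hand side.\<close>
lemma sum_log_pow_term_tail:
  assumes N: "N \<ge> 2" "N \<le> K"
    and \<beta>: "(real N + 1/2) * ln ((3 * real N + 2) / real N) \<le> \<sigma> - real k / ln (real N)"
  shows "(\<Sum>n=N..<K. log_pow_term k \<sigma> n) \<le> 3 / 2 * log_pow_term k \<sigma> N"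
proof -
  define F where "F = log_pow_term k \<sigma>"
  define T where "T n = (real n + real N / 2) / real N * F n" for n
  have "F n \<le> T n - T (n + 1)" if "N \<le> n" for n
  proof -
    have "F (n + 1) \<le> F n * (real n / real (n + 1)) powr (\<sigma> - real k / ln (real N))"
      unfolding F_def using N that by (intro log_pow_term_Suc_le) auto
    also have "\<dots> \<le> F n * ((real n - real N / 2) / (real n + 1 + real N / 2))"
      using power_ratio_le[OF _ _ \<beta>, of "real n"] N that log_pow_term_nonneg[of k \<sigma> n]
      by (intro mult_left_mono) (auto simp: F_def add.commute)
    \<comment> \<open>The fraction is (T n - F n) / F n divided by T (n + 1) / F (n + 1), so the
      estimate becomes T (n + 1) \<le> T n - F n.\<close>
    also have "F n * ((real n - real N / 2) / (real n + 1 + real N / 2)) =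
        (T n - F n) * real N / (real n + 1 + real N / 2)"
    proof -
      have "F n * (real n - real N / 2) = (T n - F n) * real N"
        using N by (simp add: T_def field_simps)
      then show ?thesis by simp
    qed
    finally have "F (n + 1) * (real n + 1 + real N / 2) \<le> (T n - F n) * real N"
      using N by (subst (asm) pos_le_divide_eq) auto
    then have "F (n + 1) * (real n + 1 + real N / 2) / real N \<le> T n - F n"
      using N by (subst pos_divide_le_eq) auto
    then show ?thesis by (simp add: T_def mult.commute add.commute)
  qed
  then have "(\<Sum>n=N..<K. F n) \<le> (\<Sum>n=N..<K. T n - T (n + 1))" by (intro sum_mono) auto
  also have "\<dots> = - (\<Sum>n=N..<K. T (Suc n) - T n)" by (simp add: sum_subtractf)
  also have "\<dots> = T N - T K" using N by (subst sum_Suc_diff') auto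
  also have "\<dots> \<le> T N" using log_pow_term_nonneg[of k \<sigma> K] by (simp add: T_def F_def)
  also have "\<dots> = 3 / 2 * F N" using N by (simp add: T_def field_simps)
  finally show ?thesis by (simp add: F_def)
qed

text \<open>Trades the gap \<open>q M - q (M + 1)\<close>, which the separation hypothesis controls,
  for the excess of \<open>q (M + 1)\<close> over 1 / ln (M + 2), which the tail estimate consumes.
  The excess is bounded below by the midpoint bound. The first factor is the \<kappa> of
  \<open>tail_exponent_bound\<close>.\<close>

lemma q_gap_bound:
  assumes "M \<ge> 2"
  shows "(ln 3 / 2 + 2 / 3 + 1 / (3 * real (M + 2))) * (q M - q (M + 1)) \<le>
    real (2 * M + 3) * ln 3 * (q (M + 1) - 1 / ln (real (M + 2)))"
proof -
  define a c b where "a = ln (real M)" and "c = ln (real (M + 1))" and "b = ln (real (M + 2))"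
  define \<kappa> where "\<kappa> = ln 3 / 2 + 2 / 3 + 1 / (3 * real (M + 2))"
  have abc: "0 < a" "a < c" "c < b" using assms by (auto simp: a_def b_def c_def)
  have "1 / b + (b - c) / (2 * b\<^sup>2) \<le> 2 / (c + b)"
  proof -
    have "2 / (c + b) - 1 / b = (b - c) / (b * (c + b))" using abc by (simp add: field_simps)
    moreover have "(b - c) / (2 * b\<^sup>2) \<le> (b - c) / (b * (c + b))"
      using abc by (intro divide_left_mono) (auto simp: power2_eq_square algebra_simps intro!: add_pos_pos)
    ultimately show ?thesis by linarith
  qed
  also have "2 / (c + b) \<le> q (M + 1)"
    using q_ge[of "M + 1"] assms by (simp add: b_def c_def add.commute)
  finally have qlow: "1 / b + (b - c) / (2 * b\<^sup>2) \<le> q (M + 1)" .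
  have \<kappa>0: "\<kappa> > 0" unfolding \<kappa>_def by (simp add: add_pos_pos)
  have "\<kappa> * (q M - q (M + 1)) \<le> real (2 * M + 3) * ln 3 * ((b - c) / (2 * b\<^sup>2))"
  proof (cases "M = 2")
    \<comment> \<open>The bound q M \<le> 1 / ln M used in the other case loses too much here, so
      the trapezoid bound and numerical values of ln 2 and ln 3 take over.\<close>
    case True
    define x y where "x = ln (2::real)" and "y = ln (3::real)"
    have x: "0.69 \<le> x" "x \<le> 0.694" and y: "1.095 \<le> y" "y \<le> 1.1"
      unfolding x_def y_def using ln_2_bounds ln_3_bounds by auto
    have "ln (4::real) = 2 * x" using ln_realpow[of 2 2] by (simp add: x_def)
    then have e: "a = x" "c = y" "b = 2 * x"
      using True by (simp_all add: a_def b_def c_def x_def y_def)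
    have "q M \<le> (1 / x + 1 / y) / 2" using q_le_trapezoid[OF assms] True by (simp add: x_def y_def)
    then have "q M \<le> 1 / (2 * x) + 1 / (2 * y)" by (simp add: add_divide_distrib)
    moreover have "1 / (2 * x) + (2 * x - y) / (8 * x\<^sup>2) \<le> q (M + 1)"
      using qlow unfolding e by (simp add: power_mult_distrib)
    ultimately have gap: "q M - q (M + 1) \<le> 1 / (2 * y) - (2 * x - y) / (8 * x\<^sup>2)" by linarith
    have x2: "x\<^sup>2 \<le> 0.694\<^sup>2" using x by (intro power_mono) auto
    have "0 < x\<^sup>2" using x by simp
    \<comment> \<open>0.28 = 2 * 0.69 - 1.1, and 3.854 is 8 * 0.694^2 rounded up.\<close>
    have "0.28 / 3.854 \<le> (2 * x - y) / (8 * x\<^sup>2)"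
      using x y x2 \<open>0 < x\<^sup>2\<close> by (intro frac_le) (auto simp: power2_eq_square)
    moreover have "1 / (2 * y) \<le> 1 / 2.19" using y by (intro divide_left_mono) auto
    ultimately have "q M - q (M + 1) \<le> 1 / 2.19 - 0.28 / 3.854" using gap by linarith
    also have "\<dots> \<le> 0.3842" by simp
    finally have gap': "q M - q (M + 1) \<le> 0.3842" .
    have "\<kappa> * (q M - q (M + 1)) \<le> \<kappa> * 0.3842"
      using gap' \<kappa>0 by (intro mult_left_mono) auto
    also have "\<dots> \<le> 1.3 * 0.3842"
      using y True by (intro mult_right_mono) (auto simp: \<kappa>_def y_def)
    also have "\<dots> \<le> 7 * 1.095 * (0.28 / 3.854)" by simp
    also have "\<dots> \<le> 7 * y * ((2 * x - y) / (8 * x\<^sup>2))"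
      using y \<open>0.28 / 3.854 \<le> _\<close> by (intro mult_mono) auto
    also have "\<dots> = real (2 * M + 3) * ln 3 * ((b - c) / (2 * b\<^sup>2))"
      unfolding e using True by (simp add: y_def power_mult_distrib)
    finally show ?thesis .
  next
    case False
    with assms have M3: "M \<ge> 3" by simp
    define d where "d = b - a"
    have "ln 3 \<le> a" using M3 by (simp add: a_def)
    then have a: "1.095 \<le> a" using ln_3_bounds by linarith
    have "d = ln (real (M + 2) / real M)" using assms by (simp add: d_def a_def b_def ln_div)
    also have "\<dots> \<le> ln (5 / 3)" using M3 by (intro ln_mono) (auto simp: field_simps)
    finally have d: "d \<le> 0.55" "0 < d" using ln_5_3_le abc by (auto simp: d_def)
    have "1 / (3 * real (M + 2)) \<le> 1 / 15" using M3 by (intro divide_left_mono) auto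
    then have "\<kappa> \<le> ln 3 / 2 + 2 / 3 + 1 / 15" unfolding \<kappa>_def by (intro add_left_mono)
    also have "\<dots> \<le> 1.2834" using ln_3_bounds by simp
    finally have \<kappa>: "\<kappa> \<le> 1.2834" .
    \<comment> \<open>The target is \<kappa> * d * b \<le> ln 3 * a, since 1/a - 1/b = d / (a * b)
      and (2 * M + 3) * (b - c) \<ge> 2. Inserting b \<le> a + 0.55 makes it linear in
      \<open>a\<close>, and it holds from a = 1.095 on.\<close>
    have "\<kappa> * d \<le> 1.2834 * 0.55" using \<kappa> d \<kappa>0 by (intro mult_mono) auto
    then have "\<kappa> * d * b \<le> 0.70587 * b" using abc by (intro mult_right_mono) auto
    also have "\<dots> \<le> 0.70587 * (a + 0.55)" using d by (simp add: d_def)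
    also have "\<dots> \<le> 1.095 * a" using a by simp
    also have "\<dots> \<le> ln 3 * a" using ln_3_bounds a by (intro mult_right_mono) auto
    finally have key: "\<kappa> * d * b \<le> ln 3 * a" .
    have "q M \<le> 1 / a" using q_le_inverse_ln[OF assms] by (simp add: a_def)
    moreover have "1 / b \<le> q (M + 1)"
      using q_ge_inverse_ln[of "M + 1"] assms by (simp add: b_def)
    ultimately have "\<kappa> * (q M - q (M + 1)) \<le> \<kappa> * (1 / a - 1 / b)"
      using \<kappa>0 by (intro mult_left_mono) auto
    also have "\<dots> = \<kappa> * d * b / (a * b\<^sup>2)"
      using abc by (simp add: d_def field_simps power2_eq_square)
    also have "\<dots> \<le> ln 3 * a / (a * b\<^sup>2)" using key abc by (intro divide_right_mono) auto
    also have "\<dots> = ln 3 * 2 / (2 * b\<^sup>2)" using abc by simp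
    also have "\<dots> \<le> ln 3 * (real (2 * M + 3) * (b - c)) / (2 * b\<^sup>2)"
    proof (intro divide_right_mono mult_left_mono)
      have "2 * (real (M + 2) - real (M + 1)) / (real (M + 1) + real (M + 2)) \<le> b - c"
        unfolding b_def c_def by (intro ln_inverse_approx_ge) auto
      then show "2 \<le> real (2 * M + 3) * (b - c)" by (simp add: field_simps)
    qed auto
    finally show ?thesis by (simp add: mult_ac)
  qed
  also have "\<dots> \<le> real (2 * M + 3) * ln 3 * (q (M + 1) - 1 / b)"
    using qlow by (intro mult_left_mono) auto
  finally show ?thesis by (simp add: \<kappa>_def b_def)
qed

text \<open>Supplies the exponent hypothesis of \<open>sum_log_pow_term_tail\<close>. The summand (M
  + 2) * ln 3 in the bound for \<sigma> covers N * ln 3. The remaining \<kappa> comes from the size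
  of \<open>k\<close>: the gap gives (q M - q (M + 1)) * k > (2 * M + 3) * ln 3, and
  \<open>q_gap_bound\<close> turns this into (q (M + 1) - 1 / ln N) * k \<ge> \<kappa>.\<close>

lemma tail_exponent_bound:
  assumes M: "M \<ge> 2"
    and gap: "q (M + 1) * real k + real (M + 2) * ln 3 < q M * real k - real (M + 1) * ln 3"
    and \<sigma>: "q (M + 1) * real k + real (M + 2) * ln 3 \<le> \<sigma>"
  defines "N \<equiv> real (M + 2)"
  shows "(N + 1/2) * ln ((3 * N + 2) / N) \<le> \<sigma> - real k / ln N"
proof -
  \<comment> \<open>Equals (N + 1/2) * (ln 3 + 2 / (3 * N)) - N * ln 3, which is what ln (1 + x)
    \<le> x leaves at x = 2 / (3 * N).\<close>
  define \<kappa> where "\<kappa> = ln 3 / 2 + 2 / 3 + 1 / (3 * N)"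
  have N: "N \<ge> 4" using M by (simp add: N_def)
  have \<kappa>0: "\<kappa> > 0" unfolding \<kappa>_def using N by (simp add: add_pos_pos)
  define C where "C = real (2 * M + 3) * ln 3"
  have C: "C > 0" by (simp add: C_def)
  have gap': "C < (q M - q (M + 1)) * k" using gap by (simp add: C_def algebra_simps)
  have "\<kappa> * C \<le> \<kappa> * ((q M - q (M + 1)) * k)"
    using gap' \<kappa>0 by (intro mult_left_mono) auto
  also have "\<dots> = \<kappa> * (q M - q (M + 1)) * k" by simp
  also have "\<dots> \<le> C * (q (M + 1) - 1 / ln N) * k"
    using q_gap_bound[OF M] unfolding N_def \<kappa>_def C_def by (intro mult_right_mono) auto
  also have "\<dots> = ((q (M + 1) - 1 / ln N) * k) * C" by simp
  finally have "\<kappa> \<le> (q (M + 1) - 1 / ln N) * k" using C by simp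
  then have "N * ln 3 + \<kappa> \<le> \<sigma> - real k / ln N"
    using \<sigma> by (simp add: N_def algebra_simps)
  moreover have "(N + 1/2) * ln ((3 * N + 2) / N) \<le> N * ln 3 + \<kappa>"
  proof -
    have "(3 * N + 2) / N = 3 * (1 + 2 / (3 * N))" using N by (simp add: field_simps)
    then have "ln ((3 * N + 2) / N) = ln 3 + ln (1 + 2 / (3 * N))"
      using N by (simp only: ln_mult_pos zero_less_numeral add_pos_pos zero_less_one divide_pos_pos mult_pos_pos)
    also have "\<dots> \<le> ln 3 + 2 / (3 * N)"
      using N by (intro add_left_mono ln_add_one_self_le_self) auto
    finally have "(N + 1/2) * ln ((3 * N + 2) / N) \<le> (N + 1/2) * (ln 3 + 2 / (3 * N))"
      using N by (intro mult_left_mono) auto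
    also have "\<dots> = N * ln 3 + \<kappa>" using N by (simp add: \<kappa>_def field_simps)
    finally show ?thesis .
  qed
  ultimately show ?thesis by linarith
qed

subsection \<open>The Dirichlet series of the derivatives\<close>

lemma summable_log_pow_term:
  assumes "\<sigma> > 1"
  shows "summable (log_pow_term k \<sigma>)"
proof (rule summable_comparison_test')
  \<comment> \<open>With ln n \<le> n^a / a, this choice costs a * k < (\<sigma> - 1) / 2 in the
    exponent, which stays below -1. The k + 1 keeps the denominator positive for k = 0.\<close>
  define a where "a = (\<sigma> - 1) / 2 / (real k + 1)"
  have a: "a > 0" using assms by (simp add: a_def)
  have "a * (real k + 1) = (\<sigma> - 1) / 2"
    by (rule nonzero_eq_divide_eq[THEN iffD1, OF _ a_def]) simp
  then have "a * real k + a = (\<sigma> - 1) / 2" by (simp add: algebra_simps)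
  then have "a * real k - \<sigma> < - 1" using a assms by (simp add: field_simps)
  then have "summable (\<lambda>n. real n powr (a * real k - \<sigma>))"
    by (subst summable_real_powr_iff) auto
  then show "summable (\<lambda>n. real n powr (a * real k - \<sigma>) / a ^ k)" by (rule summable_divide)
  show "norm (log_pow_term k \<sigma> n) \<le> real n powr (a * real k - \<sigma>) / a ^ k" if "n \<ge> 1" for n
  proof -
    have "ln (real n) ^ k \<le> (real n powr a / a) ^ k"
      using that a by (intro power_mono ln_powr_bound) auto
    also have "\<dots> = real n powr (a * real k) / a ^ k"
      using that by (simp add: power_divide powr_powr powr_realpow[symmetric])
    finally have "ln (real n) ^ k * real n powr (- \<sigma>) \<le>
        real n powr (a * real k) / a ^ k * real n powr (- \<sigma>)"
      by (intro mult_right_mono) auto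
    then show ?thesis
      using log_pow_term_nonneg[of k \<sigma> n]
      by (simp add: log_pow_term_def powr_diff powr_minus divide_inverse mult_ac)
  qed
qed

text \<open>With the sign inside the power, differentiating a term just raises \<open>k\<close> by
  one.\<close>

definition zeta_deriv_term :: "nat \<Rightarrow> nat \<Rightarrow> complex \<Rightarrow> complex" where
  "zeta_deriv_term k n s = of_real ((- ln (real n)) ^ k) * of_nat n powr (- s)"

lemma norm_zeta_deriv_term: "norm (zeta_deriv_term k n s) = log_pow_term k (Re s) n"
proof (cases n)
  case (Suc m)
  then show ?thesis
    by (simp add: zeta_deriv_term_def log_pow_term_def norm_mult norm_power norm_Suc_powr
        del: of_nat_Suc)
qed (auto simp: zeta_deriv_term_def log_pow_term_def)

lemma zeta_deriv_term_has_derivative: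
  "(zeta_deriv_term k n has_field_derivative zeta_deriv_term (Suc k) n s) (at s)"
proof (cases "n = 0")
  case True
  then show ?thesis by (simp add: zeta_deriv_term_def[abs_def])
next
  case False
  then have "((\<lambda>s. of_nat n powr (- s)) has_field_derivative
      - of_real (ln (real n)) * of_nat n powr (- s)) (at s :: complex filter)"
    unfolding powr_def by (auto intro!: derivative_eq_intros simp: Ln_of_nat)
  from DERIV_cmult[OF this, of "of_real ((- ln (real n)) ^ k)"] show ?thesis
    unfolding zeta_deriv_term_def[abs_def] by (simp add: mult_ac)
qed

lemma zeta_deriv_term_holomorphic [holomorphic_intros]: "zeta_deriv_term k n holomorphic_on A"
  by (meson zeta_deriv_term_has_derivative holomorphic_on_def field_differentiable_def
      has_field_derivative_at_within)

text \<open>Induction on \<open>k\<close> by termwise differentiation. A summable majorant of the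
  level-\<open>k\<close> terms near each point is enough, because locally uniform convergence of
  holomorphic functions passes to derivatives.\<close>

lemma zeta_deriv_sums:
  assumes "Re s > 1"
  shows "(\<lambda>n. zeta_deriv_term k n s) sums zeta_deriv k s"
  using assms
proof (induction k arbitrary: s)
  case 0
  have "(\<lambda>n. zeta_deriv_term 0 (Suc n) s) sums zeta_deriv 0 s"
    using zeta_series_sums[OF 0] 0
    by (simp add: zeta_deriv_term_def zeta_deriv_def riemann_zeta_eq_series zeta_series_def)
  \<comment> \<open>The zeta series starts at n = 1; the prepended term at 0 vanishes since
    \<open>0 powr x = 0\<close>.\<close>
  then show ?case by (subst (asm) sums_Suc_iff) (simp add: zeta_deriv_term_def)
next
  case (Suc k)
  define S where "S = {s::complex. Re s > 1}"
  have S: "open S" unfolding S_def by (rule open_halfspace_Re_gt)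
  have bd: "\<exists>d h. 0 < d \<and> summable h \<and> range h \<subseteq> \<real>\<^sub>\<ge>\<^sub>0 \<and>
      (\<forall>\<^sub>F n in sequentially. \<forall>y\<in>ball x d \<inter> S. cmod (zeta_deriv_term k n y) \<le> cmod (h n :: complex))"
    if "x \<in> S" for x
  proof (intro exI conjI)
    \<comment> \<open>Half the distance of \<open>x\<close> to the line Re s = 1, so that Re y \<ge>
      1 + d on the ball.\<close>
    define d where "d = (Re x - 1) / 2"
    show "0 < d" using that by (simp add: S_def d_def)
    then show "summable (\<lambda>n. complex_of_real (log_pow_term k (1 + d) n))"
      by (intro summable_of_real summable_log_pow_term) auto
    show "range (\<lambda>n. complex_of_real (log_pow_term k (1 + d) n)) \<subseteq> \<real>\<^sub>\<ge>\<^sub>0"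
      by (auto intro: log_pow_term_nonneg)
    have "cmod (zeta_deriv_term k n y) \<le> cmod (complex_of_real (log_pow_term k (1 + d) n))"
      if "n \<ge> 1" "y \<in> ball x d" for n y
    proof -
      have "\<bar>Re (x - y)\<bar> < d"
        using that(2) abs_Re_le_cmod[of "x - y"] by (simp add: dist_norm)
      then have "Re x - d \<le> Re y" by simp
      moreover have "Re x = 1 + 2 * d" by (simp add: d_def field_simps)
      ultimately have "1 + d \<le> Re y" by linarith
      then have "real n powr (- Re y) \<le> real n powr (- (1 + d))"
        using that by (intro powr_mono) auto
      then show ?thesis
        using that log_pow_term_nonneg[of k "1 + d" n]
        by (simp add: norm_zeta_deriv_term) (simp add: log_pow_term_def mult_left_mono)
    qed
    then show "\<forall>\<^sub>F n in sequentially. \<forall>y\<in>ball x d \<inter> S.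
        cmod (zeta_deriv_term k n y) \<le> cmod (complex_of_real (log_pow_term k (1 + d) n))"
      by (intro eventually_sequentiallyI[of 1] ballI) blast
  qed
  obtain g g' where g: "\<And>x. x \<in> S \<Longrightarrow> (\<lambda>n. zeta_deriv_term k n x) sums g x"
    and g': "\<And>x. x \<in> S \<Longrightarrow> (\<lambda>n. zeta_deriv_term (Suc k) n x) sums g' x"
    and gd: "\<And>x. x \<in> S \<Longrightarrow> (g has_field_derivative g' x) (at x)"
    using series_and_derivative_comparison_complex[OF S zeta_deriv_term_has_derivative bd] by metis
  have s: "s \<in> S" using Suc.prems by (simp add: S_def)
  have "g x = zeta_deriv k x" if "x \<in> S" for x
    using g[OF that] Suc.IH[of x] that sums_unique2 by (auto simp: S_def)
  then have "(zeta_deriv k has_field_derivative g' s) (at s)"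
    by (rule has_field_derivative_transform_within_open[OF gd[OF s] S s])
  then have "zeta_deriv (Suc k) s = g' s"
    by (simp add: zeta_deriv_def DERIV_imp_deriv)
  then show ?case using g'[OF s] by simp
qed

lemma zeta_deriv_holomorphic: "zeta_deriv k holomorphic_on - {1}"
  unfolding zeta_deriv_def by (intro holomorphic_higher_deriv riemann_zeta_holomorphic) auto

lemma zeta_deriv_term_eq:
  assumes "n \<ge> 2"
  shows "zeta_deriv_term k n s =
    (- 1) ^ k * exp (of_real (real k * ln (ln (real n))) - s * of_real (ln (real n)))"
proof -
  have "(- ln (real n)) ^ k = (- 1) ^ k * ln (real n) ^ k" by (rule power_minus)
  also have "ln (real n) ^ k = exp (real k * ln (ln (real n)))"
    using assms by (simp add: exp_of_nat_mult)
  finally have "complex_of_real ((- ln (real n)) ^ k) =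
      (- 1) ^ k * exp (of_real (real k * ln (ln (real n))))"
    by (simp flip: exp_of_real)
  moreover have "of_nat n powr (- s) = exp (- s * of_real (ln (real n)))"
    using assms by (simp add: powr_def Ln_of_nat)
  ultimately show ?thesis
    by (simp only: zeta_deriv_term_def mult.assoc flip: exp_add) simp
qed

text \<open>Complex counterpart of \<open>log_pow_term_Suc\<close>; it keeps the argument of the
  quotient, from which the zeros of the two-term sum and its size on the horizontal sides are read
  off.\<close>

lemma zeta_deriv_term_Suc:
  assumes "n \<ge> 2"
  shows "zeta_deriv_term k (n + 1) s = zeta_deriv_term k n s *
    exp (of_real (ln (real (n + 1)) - ln (real n)) * (of_real (q n * real k) - s))"
proof -
  define a b where "a = ln (real n)" and "b = ln (real (n + 1))"
  have ab: "0 < a" "a < b" using assms by (auto simp: a_def b_def)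
  have "q n * (b - a) = ln b - ln a"
    using ab unfolding q_eq[OF assms] a_def[symmetric] b_def[symmetric] by simp
  then have "ln b = ln a + q n * (b - a)" by simp
  then have "complex_of_real (k * ln b) - s * of_real b =
      of_real (k * ln a) - s * of_real a + of_real (b - a) * (of_real (q n * real k) - s)"
    by (simp only:) (simp add: algebra_simps)
  then show ?thesis
    unfolding zeta_deriv_term_eq[OF assms] zeta_deriv_term_eq[OF trans_le_add1[OF assms]]
      a_def[symmetric] b_def[symmetric]
    by (simp add: exp_add)
qed

lemma exp_eq_minus_one_iff: "exp z = - 1 \<longleftrightarrow> (\<exists>n::int. z = of_real ((2 * of_int n + 1) * pi) * \<i>)"
proof -
  have "exp z = - 1 \<longleftrightarrow> exp z = exp (of_real pi * \<i>)" by (simp add: mult.commute)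
  also have "\<dots> \<longleftrightarrow> (\<exists>n::int. z = of_real ((2 * of_int n + 1) * pi) * \<i>)"
    unfolding exp_eq by (intro arg_cong[of _ _ Ex] ext) (simp add: algebra_simps)
  finally show ?thesis .
qed

subsection \<open>Comparison with the two dominant terms\<close>

locale separated_strip =
  fixes M k :: nat
  assumes M: "M \<ge> 2" and k: "k \<ge> 1"
    and separated: "q (M + 1) * real k + real (M + 2) * ln 3 < q M * real k - real (M + 1) * ln 3"
begin

definition lo :: real where "lo = q M * real k - real (M + 1) * ln 3"
definition hi :: real where "hi = q M * real k + real (M + 1) * ln 3"
text \<open>The quotient of the two dominant terms has period 2 * pi / \<delta> in Im s, which is
  the height of the rectangles.\<close>

definition \<delta> :: real where "\<delta> = ln (real (M + 1)) - ln (real M)"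

definition main_part :: "complex \<Rightarrow> complex" where
  "main_part s = zeta_deriv_term k M s + zeta_deriv_term k (M + 1) s"

lemma \<delta>_pos: "\<delta> > 0"
  using M by (simp add: \<delta>_def)

lemma lo_less_hi: "lo < hi"
  by (simp add: lo_def hi_def)

text \<open>Keeps the strip in the half-plane of convergence, with room to enlarge the rectangles by
  1 to the left.\<close>

lemma lo_gt: "lo > 4"
proof -
  have "4 * 1.095 \<le> real (M + 2) * ln 3"
    using M ln_3_bounds by (intro mult_mono) auto
  moreover have "0 \<le> q (M + 1) * real k" using q_nonneg[of "M + 1"] M by simp
  ultimately have "4 < q (M + 1) * real k + real (M + 2) * ln 3" by simp
  then show ?thesis using separated by (simp add: lo_def)
qed

text \<open>Convexity of \<open>q\<close> transfers the assumed gap between the strips of \<open>M + 1\<close> and \<open>M\<close> to the strips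
  to the right of the one of \<open>M\<close>.\<close>
lemma hi_le_left_of_strip:
  assumes "2 \<le> n" "n < M"
  shows "hi \<le> q n * real k - real (n + 1) * ln 3"
proof -
  obtain m where m: "M = m + 1" "n \<le> m" using assms by (cases M) auto
  have "(q M - q (M + 1)) * k \<le> (q m - q M) * k"
    using q_convex[of m] m assms by (intro mult_right_mono) (auto simp: add.commute)
  moreover have "real (2 * M + 3) * ln 3 < (q M - q (M + 1)) * k"
    using separated by (simp add: algebra_simps)
  moreover have "real (2 * M + 1) * ln 3 \<le> real (2 * M + 3) * ln 3"
    by (intro mult_right_mono) auto
  ultimately have "real (2 * M + 1) * ln 3 \<le> (q m - q M) * k" by linarith
  then have "hi \<le> q m * k - real M * ln 3" by (simp add: hi_def algebra_simps)
  also have "\<dots> \<le> q n * k - real (n + 1) * ln 3"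
    using q_antimono[of n m] assms m by (intro diff_mono mult_right_mono) auto
  finally show ?thesis .
qed

text \<open>The terms below \<open>M\<close> give at most F M / 2. Those from M + 2 on give at most
  3/2 * F (M + 2), and F (M + 2) \<le> F (M + 1) / 3 to the right of the strip of M + 1. Both bounds
  are uniform over partial sums and survive the limit.\<close>

lemma remainder_bound:
  assumes "lo \<le> Re s" "Re s \<le> hi"
  shows "cmod (zeta_deriv k s - main_part s) \<le>
    (log_pow_term k (Re s) M + log_pow_term k (Re s) (M + 1)) / 2"
proof -
  define F where "F = log_pow_term k (Re s)"
  define r where "r n = zeta_deriv_term k n s -
    (if n \<in> {M, M + 1} then zeta_deriv_term k n s else 0)" for n
  have "(\<lambda>n. if n \<in> {M, M + 1} then zeta_deriv_term k n s else 0) sums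
      (\<Sum>n\<in>{M, M + 1}. zeta_deriv_term k n s)"
    by (rule sums_If_finite_set) auto
  then have "(\<lambda>n. if n \<in> {M, M + 1} then zeta_deriv_term k n s else 0) sums main_part s"
    by (simp add: main_part_def)
  from sums_diff[OF zeta_deriv_sums this] have "r sums (zeta_deriv k s - main_part s)"
    unfolding r_def using assms lo_gt by auto
  then have "(\<lambda>K. \<Sum>n<K. r n) \<longlonglongrightarrow> zeta_deriv k s - main_part s"
    by (simp add: sums_def)
  then show ?thesis
  proof (rule Lim_norm_ubound[rotated])
    have "cmod (\<Sum>n<K. r n) \<le> (F M + F (M + 1)) / 2" if K: "K \<ge> M + 2" for K
    proof -
      have split: "{..<K} = {..<2} \<union> ({2..<M} \<union> ({M, M + 1} \<union> {M + 2..<K}))"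
        using K M by auto
      \<comment> \<open>Index 1 vanishes through ln 1 = 0 and k \<ge> 1; the terms at M and M + 1
        were subtracted.\<close>
      have zero: "r 0 = 0" "r 1 = 0" "r M = 0" "r (M + 1) = 0"
        using k M by (auto simp: r_def zeta_deriv_term_def)
      have "(\<Sum>n<K. r n) = (\<Sum>n<2. r n) + ((\<Sum>n=2..<M. r n) +
          ((\<Sum>n\<in>{M, M + 1}. r n) + (\<Sum>n=M+2..<K. r n)))"
        unfolding split using M by (subst sum.union_disjoint; force?)+
      also have "\<dots> = (\<Sum>n=2..<M. r n) + (\<Sum>n=M+2..<K. r n)"
        using zero by (simp add: eval_nat_numeral)
      finally have "cmod (\<Sum>n<K. r n) \<le> (\<Sum>n=2..<M. cmod (r n)) + (\<Sum>n=M+2..<K. cmod (r n))"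
        by (simp only:) (intro norm_triangle_mono norm_sum)
      also have "\<dots> \<le> (\<Sum>n=2..<M. F n) + (\<Sum>n=M+2..<K. F n)"
        by (intro add_mono sum_mono) (auto simp: r_def norm_zeta_deriv_term F_def log_pow_term_nonneg)
      also have "(\<Sum>n=2..<M. F n) \<le> F M / 2"
        unfolding F_def using M hi_le_left_of_strip assms
        by (intro sum_log_pow_term_head) force+
      also have "(\<Sum>n=M+2..<K. F n) \<le> 3 / 2 * F (M + 2)"
        unfolding F_def using M K assms separated
        by (intro sum_log_pow_term_tail tail_exponent_bound) (auto simp: lo_def)
      also have "F (M + 2) \<le> F (M + 1) / 3"
        unfolding F_def using log_pow_term_right[of "M + 1" k "Re s"] M assms separated
        by (simp add: lo_def algebra_simps)
      finally show ?thesis by (simp add: field_simps)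
    qed
    then show "\<forall>\<^sub>F K in sequentially. cmod (\<Sum>n<K. r n) \<le>
        (log_pow_term k (Re s) M + log_pow_term k (Re s) (M + 1)) / 2"
      unfolding F_def by (rule eventually_sequentiallyI)
  qed simp
qed

lemma main_part_eq:
  "main_part s = zeta_deriv_term k M s * (1 + exp (of_real \<delta> * (of_real (q M * real k) - s)))"
  unfolding main_part_def zeta_deriv_term_Suc[OF M] \<delta>_def by (simp add: algebra_simps)

text \<open>Half the sum of the moduli is the quantity to beat. For x, y > 0 the condition x - y >
  (x + y) / 2 is x > 3 * y, which is what the edges of the strip provide.\<close>

lemma remainder_less_main_part:
  assumes "lo \<le> Re s" "Re s \<le> hi"
    and "Re s = lo \<or> Re s = hi \<or> (\<exists>j::int. Im s = 2 * pi * of_int j / \<delta>)"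
  shows "cmod (zeta_deriv k s - main_part s) < cmod (main_part s)"
proof -
  define F where "F = log_pow_term k (Re s)"
  have pos: "F M > 0" "F (M + 1) > 0" unfolding F_def using M by (auto intro!: log_pow_term_pos)
  have tri: "F M - F (M + 1) \<le> cmod (main_part s)" "F (M + 1) - F M \<le> cmod (main_part s)"
    unfolding main_part_def F_def norm_zeta_deriv_term[symmetric]
    by (metis norm_diff_ineq, metis norm_diff_ineq add.commute)
  consider "Re s = lo" | "Re s = hi" | j :: int where "Im s = 2 * pi * of_int j / \<delta>"
    using assms(3) by blast
  then have "(F M + F (M + 1)) / 2 < cmod (main_part s)"
  proof cases
    case 1
    then have "F M < F (M + 1) / 3"
      unfolding F_def using M by (intro log_pow_term_left) (auto simp: lo_def)
    then show ?thesis using tri by simp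
  next
    case 2
    then have "F (M + 1) < F M / 3"
      unfolding F_def using M by (intro log_pow_term_right) (auto simp: hi_def)
    then show ?thesis using tri by simp
  next
    case 3
    \<comment> \<open>At these heights the quotient of the two terms is the positive real
      \<open>exp x\<close>, so their moduli add without cancellation.\<close>
    define x where "x = \<delta> * (q M * real k - Re s)"
    have "\<delta> * Im s = 2 * pi * of_int j" using 3 \<delta>_pos by simp
    then have "of_real \<delta> * (of_real (q M * real k) - s) =
        of_real x + of_int (- j) * (of_real (2 * pi) * \<i>)"
      by (simp add: complex_eq_iff x_def algebra_simps)
    also have "exp \<dots> = exp (of_real x)"
      by (subst exp_eq) (auto intro!: exI[of _ "- j"] simp: algebra_simps)
    also have "\<dots> = of_real (exp x)" by (rule exp_of_real)
    finally have e: "exp (of_real \<delta> * (of_real (q M * real k) - s)) = of_real (exp x)" .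
    have "F (M + 1) = F M * exp x"
      unfolding F_def norm_zeta_deriv_term[symmetric] zeta_deriv_term_Suc[OF M] \<delta>_def[symmetric] e
      by (simp add: norm_mult)
    moreover have "cmod (main_part s) = F M * (1 + exp x)"
    proof -
      have "main_part s = zeta_deriv_term k M s * of_real (1 + exp x)"
        unfolding main_part_eq e by simp
      then show ?thesis
        unfolding F_def norm_zeta_deriv_term[symmetric]
        by (simp only: norm_mult norm_of_real) (simp add: add_pos_pos)
    qed
    ultimately show ?thesis using pos by (simp add: algebra_simps add_pos_pos)
  qed
  then show ?thesis using remainder_bound[OF assms(1,2)] unfolding F_def by linarith
qed

section \<open>Zeros of the main part and Rouche's theorem\<close>

lemma main_part_eq_0_iff:
  "main_part s = 0 \<longleftrightarrow>
    (\<exists>n::int. s = Complex (q M * real k) ((2 * of_int n + 1) * pi / \<delta>))"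
proof -
  have "zeta_deriv_term k M s \<noteq> 0"
    using norm_zeta_deriv_term[of k M s] log_pow_term_pos[OF M, of k "Re s"] by force
  then have "main_part s = 0 \<longleftrightarrow> exp (of_real \<delta> * (of_real (q M * real k) - s)) = - 1"
    unfolding main_part_eq by (simp add: add_eq_0_iff)
  also have "\<dots> \<longleftrightarrow> (\<exists>n::int. of_real \<delta> * (of_real (q M * real k) - s) =
      of_real ((2 * of_int n + 1) * pi) * \<i>)"
    by (rule exp_eq_minus_one_iff)
  also have "\<dots> \<longleftrightarrow> (\<exists>n::int. s = Complex (q M * real k) (- ((2 * of_int n + 1) * pi / \<delta>)))"
    using \<delta>_pos by (intro arg_cong[of _ _ Ex] ext) (auto simp: complex_eq_iff field_simps)
  also have "\<dots> \<longleftrightarrow> (\<exists>n::int. s = Complex (q M * real k) ((2 * of_int n + 1) * pi / \<delta>))"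
  proof -
    \<comment> \<open>Replacing n by - n - 1 turns 2 * n + 1 into its negative and absorbs the
      sign.\<close>
    have e: "- ((2 * of_int n + 1) * pi / \<delta>) = (2 * of_int (- n - 1) + 1) * pi / \<delta>" for n :: int
      using \<delta>_pos by (simp add: field_simps)
    have "(\<exists>n::int. P (- n - 1)) \<longleftrightarrow> (\<exists>n. P n)" for P :: "int \<Rightarrow> bool"
      by (metis add_diff_cancel diff_minus_eq_add minus_diff_eq uminus_add_conv_diff)
    from this[of "\<lambda>n. s = Complex (q M * real k) ((2 * of_int n + 1) * pi / \<delta>)"]
    show ?thesis unfolding e .
  qed
  finally show ?thesis .
qed

lemma main_part_holomorphic [holomorphic_intros]: "main_part holomorphic_on A"
  unfolding main_part_def[abs_def] by (intro holomorphic_intros)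

text \<open>At a zero the factor 1 + e vanishes, so only its derivative contributes, and that is
  \<delta> times a nonvanishing term.\<close>

lemma zorder_main_part:
  assumes "main_part p = 0"
  shows "zorder main_part p = 1"
proof -
  define e where "e = (\<lambda>s :: complex. exp (of_real \<delta> * (of_real (q M * real k) - s)))"
  have nz: "zeta_deriv_term k M p \<noteq> 0"
    using norm_zeta_deriv_term[of k M p] log_pow_term_pos[OF M, of k "Re p"] by force
  have ep: "e p = - 1" using assms nz unfolding main_part_eq e_def by (simp add: add_eq_0_iff)
  have "(main_part has_field_derivative
      zeta_deriv_term (Suc k) M p * (1 + e p) + (e p * (- of_real \<delta>)) * zeta_deriv_term k M p) (at p)"
    unfolding main_part_eq[abs_def] e_def
    by (auto intro!: derivative_eq_intros zeta_deriv_term_has_derivative)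
  then have "deriv main_part p = of_real \<delta> * zeta_deriv_term k M p"
    by (simp add: DERIV_imp_deriv ep)
  then have "deriv main_part p \<noteq> 0" using nz \<delta>_pos by simp
  then show ?thesis
    using assms by (intro zorder_zero_eqI[OF main_part_holomorphic open_UNIV UNIV_I]) auto
qed

text \<open>Rouche's theorem gives total order 1 inside; every zero has order at least 1, so there
  is one zero and it is simple. \<open>j\<close> is an integer so that the part of the strip below
  the real axis is covered too.\<close>

lemma zero_in_rectangle:
  fixes j :: int
  defines "R \<equiv> box (Complex lo (2 * pi * of_int j / \<delta>)) (Complex hi (2 * pi * of_int (j + 1) / \<delta>))"
  shows "\<exists>p. {s \<in> R. zeta_deriv k s = 0} = {p} \<and> zorder (zeta_deriv k) p = 1"
proof -
  define y0 y1 where "y0 = 2 * pi * of_int j / \<delta>" and "y1 = 2 * pi * of_int (j + 1) / \<delta>"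
  define \<eta> where "\<eta> = pi / \<delta>"
  have \<eta>: "\<eta> > 0" using \<delta>_pos by (simp add: \<eta>_def)
  have y: "y0 = 2 * of_int j * \<eta>" "y1 = 2 * of_int j * \<eta> + 2 * \<eta>"
    using \<delta>_pos by (auto simp: y0_def y1_def \<eta>_def field_simps)
  define a b where "a = Complex lo y0" and "b = Complex hi y1"
  have ab: "Re a \<le> Re b" "Im a \<le> Im b" using lo_less_hi y \<eta> by (auto simp: a_def b_def)
  have R: "R = box a b" by (simp add: R_def a_def b_def y0_def y1_def)
  \<comment> \<open>The vertical margin \<eta> is half the height of the rectangle: the neighbouring
    zeros of \<open>main_part\<close>, at heights y0 - \<eta> and y1 + \<eta>, fall on the border of
    the open box \<open>U\<close> and are excluded.\<close>
  define K where "K = cbox (Complex (lo - 1) (y0 - \<eta>)) (Complex (hi + 1) (y1 + \<eta>))"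
  define U where "U = box (Complex (lo - 1) (y0 - \<eta>)) (Complex (hi + 1) (y1 + \<eta>))"
  define H where "H = {s::complex. Re s > 1}"
  have H: "open H" "connected H" unfolding H_def
    by (auto intro: open_halfspace_Re_gt convex_connected convex_halfspace_Re_gt)
  have KH: "K \<subseteq> H" using lo_gt by (auto simp: K_def H_def in_cbox_complex_iff)
  have UK: "U \<subseteq> K" unfolding U_def K_def by (rule box_subset_cbox)
  have RU: "cbox a b \<subseteq> U"
    using \<eta> by (auto simp: U_def a_def b_def in_cbox_complex_iff in_box_complex_iff)
  have hol: "zeta_deriv k holomorphic_on H"
    by (rule holomorphic_on_subset[OF zeta_deriv_holomorphic]) (auto simp: H_def)
  have less: "cmod (zeta_deriv k z - main_part z) < cmod (main_part z)"
    if "z \<in> path_image (rectpath a b)" for z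
  proof (rule remainder_less_main_part)
    have z: "(Re z = lo \<or> Re z = hi) \<and> y0 \<le> Im z \<and> Im z \<le> y1 \<or>
        (Im z = y0 \<or> Im z = y1) \<and> lo \<le> Re z \<and> Re z \<le> hi"
      using that unfolding path_image_rectpath[OF ab] by (auto simp: a_def b_def)
    then show "lo \<le> Re z" "Re z \<le> hi" using lo_less_hi by auto
    show "Re z = lo \<or> Re z = hi \<or> (\<exists>j::int. Im z = 2 * pi * of_int j / \<delta>)"
      using z unfolding y0_def y1_def by blast
  qed
  have "a \<in> path_image (rectpath a b)" using pathstart_in_path_image[of "rectpath a b"] by simp
  from less[OF this] have a_nz: "zeta_deriv k a \<noteq> 0" by auto
  have aU: "a \<in> U" using RU ab by (auto simp: in_cbox_complex_iff)
  define Z where "Z = {p \<in> U. zeta_deriv k p = 0}"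
  \<comment> \<open>The identity theorem settles the nonconstant case; a constant function would
    have its nonzero value at the corner \<open>a\<close> everywhere.\<close>
  have "finite {z \<in> K. zeta_deriv k z = 0}"
  proof (cases "zeta_deriv k constant_on H")
    case True
    then obtain c where c: "\<And>z. z \<in> H \<Longrightarrow> zeta_deriv k z = c" unfolding constant_on_def by blast
    have "a \<in> H" using aU UK KH by blast
    then have "c \<noteq> 0" using a_nz c by simp
    then have "{z \<in> K. zeta_deriv k z = 0} = {}" using c KH by auto
    then show ?thesis by (simp only: finite.emptyI)
  next
    case False
    then show ?thesis
      by (intro holomorphic_compact_finite_zeros[OF hol H _ KH]) (auto simp: K_def)
  qed
  then have finZ: "finite Z" by (rule rev_finite_subset) (use UK in \<open>auto simp: Z_def\<close>)
  define p0 where "p0 = Complex (q M * real k) ((2 * of_int j + 1) * pi / \<delta>)"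
  have p0R: "p0 \<in> R"
    using \<eta> \<delta>_pos by (auto simp: R in_box_complex_iff p0_def a_def b_def lo_def hi_def y \<eta>_def
        field_simps intro!: add_pos_nonneg)
  have zeros_main: "{p \<in> U. main_part p = 0} = {p0}"
  proof
    show "{p0} \<subseteq> {p \<in> U. main_part p = 0}"
      using p0R box_subset_cbox[of a b] RU main_part_eq_0_iff[of p0] by (auto simp: R p0_def)
    show "{p \<in> U. main_part p = 0} \<subseteq> {p0}"
    proof
      fix p assume "p \<in> {p \<in> U. main_part p = 0}"
      then obtain n :: int where n: "p = Complex (q M * real k) ((2 * of_int n + 1) * pi / \<delta>)"
        and pU: "p \<in> U" using main_part_eq_0_iff by auto
      have "Im p = (2 * of_int n + 1) * \<eta>" by (simp add: n \<eta>_def)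
      moreover have "y0 - \<eta> < Im p" "Im p < y1 + \<eta>"
        using pU by (auto simp: U_def in_box_complex_iff)
      ultimately have "(2 * of_int j - 1) * \<eta> < (2 * of_int n + 1) * \<eta>"
        "(2 * of_int n + 1) * \<eta> < (2 * of_int j + 3) * \<eta>"
        by (auto simp: y algebra_simps)
      then have "(2 * of_int j - 1 :: real) < 2 * of_int n + 1" "(2 * of_int n + 1 :: real) < 2 * of_int j + 3"
        using \<eta> by (auto simp: mult_less_cancel_right)
      then have "n = j" by linarith
      then show "p \<in> {p0}" by (simp add: n p0_def)
    qed
  qed
  have inside: "winding_number (rectpath a b) p = 1" if "p \<in> R" for p
    using that unfolding R by (rule winding_number_rectpath)
  have fg: "(\<lambda>p. main_part p + (zeta_deriv k p - main_part p)) = zeta_deriv k" by auto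
  have "(\<Sum>p\<in>{p \<in> U. main_part p + (zeta_deriv k p - main_part p) = 0}.
        winding_number (rectpath a b) p *
          of_int (zorder (\<lambda>p. main_part p + (zeta_deriv k p - main_part p)) p)) =
      (\<Sum>p\<in>{p \<in> U. main_part p = 0}. winding_number (rectpath a b) p * of_int (zorder main_part p))"
  proof (rule Rouche_theorem)
    show "open U" "connected U" unfolding U_def by (auto intro: convex_connected)
    show "finite {p \<in> U. main_part p + (zeta_deriv k p - main_part p) = 0}"
      using finZ by (simp add: Z_def)
    show "finite {p \<in> U. main_part p = 0}" unfolding zeros_main by simp
    show "main_part holomorphic_on U" by (rule main_part_holomorphic)
    show "(\<lambda>p. zeta_deriv k p - main_part p) holomorphic_on U"
      using UK KH by (intro holomorphic_intros holomorphic_on_subset[OF hol]) auto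
    show "path_image (rectpath a b) \<subseteq> U"
      using path_image_rectpath_subset_cbox[OF ab] RU by blast
    show "\<forall>z\<in>path_image (rectpath a b). cmod (zeta_deriv k z - main_part z) < cmod (main_part z)"
      using less by blast
    show "\<forall>z. z \<notin> U \<longrightarrow> winding_number (rectpath a b) z = 0"
      using RU ab by (auto intro!: winding_number_rectpath_outside)
  qed auto
  also have "\<dots> = 1"
  proof -
    have "main_part p0 = 0" using zeros_main by blast
    then show ?thesis by (simp add: zeros_main inside[OF p0R] zorder_main_part)
  qed
  finally have sum1: "(\<Sum>p\<in>Z. winding_number (rectpath a b) p * of_int (zorder (zeta_deriv k) p)) = 1"
    unfolding fg by (simp add: Z_def)
  define W where "W = {s \<in> R. zeta_deriv k s = 0}"
  have WZ: "W \<subseteq> Z" using RU box_subset_cbox[of a b] by (auto simp: W_def Z_def R)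
  \<comment> \<open>The strict inequality keeps zeros off the contour, so a zero in \<open>U\<close>
    but not in \<open>R\<close> lies outside the closed rectangle.\<close>
  have outside: "winding_number (rectpath a b) p = 0" if "p \<in> Z - W" for p
  proof (rule winding_number_rectpath_outside[OF ab])
    show "p \<notin> cbox a b"
    proof
      assume "p \<in> cbox a b"
      then have "p \<in> path_image (rectpath a b)"
        using that unfolding path_image_rectpath_cbox_minus_box[OF ab] by (auto simp: Z_def W_def R)
      from less[OF this] show False using that by (auto simp: Z_def)
    qed
  qed
  have "(\<Sum>p\<in>Z. winding_number (rectpath a b) p * of_int (zorder (zeta_deriv k) p)) =
      (\<Sum>p\<in>W. winding_number (rectpath a b) p * of_int (zorder (zeta_deriv k) p))"
    using finZ WZ outside by (intro sum.mono_neutral_right) auto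
  also have "\<dots> = (\<Sum>p\<in>W. of_int (zorder (zeta_deriv k) p))"
    using inside by (intro sum.cong) (auto simp: W_def)
  also have "\<dots> = complex_of_int (\<Sum>p\<in>W. zorder (zeta_deriv k) p)" by simp
  finally have sumW: "(\<Sum>p\<in>W. zorder (zeta_deriv k) p) = 1"
    using sum1 by (metis of_int_1 of_int_eq_iff)
  have order: "zorder (zeta_deriv k) p \<ge> 1" if "p \<in> W" for p
  proof -
    have "p \<in> H" using that WZ UK KH by (auto simp: Z_def)
    moreover have "\<exists>w\<in>H. zeta_deriv k w \<noteq> 0" using a_nz aU UK KH by blast
    ultimately show ?thesis
      using zorder_exist_zero[OF hol H, of p] that by (auto simp: W_def)
  qed
  have finW: "finite W" using finZ WZ by (rule rev_finite_subset)
  have "int (card W) \<le> (\<Sum>p\<in>W. zorder (zeta_deriv k) p)"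
    using sum_mono[of W "\<lambda>_. 1" "zorder (zeta_deriv k)"] order by simp
  then have "card W \<le> 1" using sumW by simp
  moreover have "W \<noteq> {}" using sumW by auto
  ultimately have "card W = 1" using finW by (simp add: le_Suc_eq)
  then obtain p where p: "W = {p}" by (auto simp: card_1_singleton_iff)
  then have "zorder (zeta_deriv k) p = 1" using sumW by simp
  then show ?thesis using p unfolding W_def by blast
qed

lemma in_rectangle_iff:
  "s \<in> box (Complex lo (2 * pi * of_int j / \<delta>)) (Complex hi (2 * pi * of_int (j + 1) / \<delta>)) \<longleftrightarrow>
    lo < Re s \<and> Re s < hi \<and> 2 * pi * of_int j / \<delta> < Im s \<and> Im s < 2 * pi * of_int (j + 1) / \<delta>"
  by (auto simp: in_box_complex_iff)

text \<open>At a zero the remainder and the main part have equal modulus, so by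
  \<open>remainder_less_main_part\<close> the zero avoids all sides and lies in an open rectangle,
  whose index is found by rounding down and may be negative.\<close>

lemma zero_in_strip_simple:
  assumes "lo \<le> Re s" "Re s \<le> hi" "zeta_deriv k s = 0"
  shows "zorder (zeta_deriv k) s = 1"
proof -
  define j where "j = \<lfloor>Im s * \<delta> / (2 * pi)\<rfloor>"
  have "\<not> (Re s = lo \<or> Re s = hi \<or> (\<exists>j::int. Im s = 2 * pi * of_int j / \<delta>))"
    using remainder_less_main_part[OF assms(1,2)] assms(3) by auto
  then have ne: "Re s \<noteq> lo" "Re s \<noteq> hi" "Im s \<noteq> 2 * pi * of_int j / \<delta>" by auto
  have "of_int j \<le> Im s * \<delta> / (2 * pi)" "Im s * \<delta> / (2 * pi) < of_int (j + 1)"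
    unfolding j_def by (simp_all add: floor_correct)
  then have "2 * pi * of_int j / \<delta> \<le> Im s" "Im s < 2 * pi * of_int (j + 1) / \<delta>"
    using \<delta>_pos by (simp_all add: field_simps)
  with ne assms show ?thesis
    using zero_in_rectangle[of j] in_rectangle_iff[of s j] by force
qed

end

theorem theorem2:
  fixes M k :: nat
  assumes "M \<ge> 2" and "k \<ge> 3"
    and "q (M + 1) * real k + real (M + 2) * ln 3 < q M * real k - real (M + 1) * ln 3"
  shows "(\<forall>j :: nat. \<exists>!s. s \<in> critical_rectangle M k j \<and> zeta_deriv k s = 0) \<and>
         (\<forall>s \<in> critical_strip M k. zeta_deriv k s = 0 \<longrightarrow> zorder (zeta_deriv k) s = 1)"
proof (intro conjI allI ballI impI)
  interpret separated_strip M k using assms by unfold_locales auto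
  fix j :: nat
  have "critical_rectangle M k j =
      box (Complex lo (2 * pi * of_int (int j) / \<delta>)) (Complex hi (2 * pi * of_int (int j + 1) / \<delta>))"
    by (auto simp: critical_rectangle_def in_box_complex_iff lo_def hi_def \<delta>_def add.commute)
  moreover obtain p where "{s \<in> box (Complex lo (2 * pi * of_int (int j) / \<delta>))
      (Complex hi (2 * pi * of_int (int j + 1) / \<delta>)). zeta_deriv k s = 0} = {p}"
    using zero_in_rectangle[of "int j"] by blast
  ultimately show "\<exists>!s. s \<in> critical_rectangle M k j \<and> zeta_deriv k s = 0"
    by (intro ex1I[of _ p]) auto
next
  interpret separated_strip M k using assms by unfold_locales auto
  fix s assume "s \<in> critical_strip M k" "zeta_deriv k s = 0"
  then show "zorder (zeta_deriv k) s = 1"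
    by (intro zero_in_strip_simple) (auto simp: critical_strip_def lo_def hi_def)
qed

end
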